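(* Fix $\delta\in[0,1]$ and consider the adder-erasure RAC: for each $k$, the inputs satisfy $X_1,\dots,X_k\in\{0,1\}$, and the output is $$Y_k=\begin{cases}\sum_{i=1}^kX_i & \text{with probability }1-\delta,\\ \mathsf e & \text{with probability }\delta,\end{cases}$$ with output alphabet $\{0,\dots,k\}\cup\{\mathsf e\}$. For each $k$, the mutual information $I_k(X_{[k]};Y_k)$, maximized over independent input distributions $P_{X_1}\times\dots\times P_{X_k}$, is attained when every $X_i\sim\mathrm{Bernoulli}(1/2)$. Under this input distribution, as $k\to\infty$ (natural logarithms), $$I_k(X_{[k]};Y_k)=(1-\delta)\Big(\frac12\ln\frac{\pi ek}2-\frac1{12k^2}\Big)+O(k^{-3})\ \text{nats},$$ $$V_k=(1-\delta)\Big[\frac\delta4\ln^2\frac{\pi ek}2+\frac12-\frac1{2k}-\Big(\frac12+\frac{\delta\ln\frac{\pi ek}2}{12}\Big)\frac1{k^2}\Big]+O\Big(\frac{\ln k}{k^3}\Big)\ \text{nats}^2,$$ where $V_k=\mathrm{Var}[\imath_k(X_{[k]};Y_k)]$.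
   Context: The information density is $\imath_k(x_{[k]};y)=\ln\frac{P_{Y_k|X_{[k]}}(y|x_{[k]})}{P_{Y_k}(y)}$, and $I_k(X_{[k]};Y_k)=\mathbb E[\imath_k(X_{[k]};Y_k)]$, both computed under the stated input distribution. *)

theory Defs
  imports "HOL-Analysis.Analysis" "HOL-Library.Landau_Symbols"
begin

text \<open>Adder-erasure random access channel with k binary inputs.
  An input tuple (X_1,...,X_k) is a bool list of length k (True = 1).
  An output is None (the erasure symbol e) or Some s with s in {0..k}.\<close>

definition rac_inputs :: "nat \<Rightarrow> bool list set" where
  "rac_inputs k = {xs. length xs = k}"

definition rac_outputs :: "nat \<Rightarrow> nat option set" where
  "rac_outputs k = insert None (Some ` {0..k})"

definition rac_PX :: "(nat \<Rightarrow> real) \<Rightarrow> bool list \<Rightarrow> real" where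
  "rac_PX p xs = (\<Prod>i<length xs. if xs ! i then p i else 1 - p i)"

definition rac_PYX :: "real \<Rightarrow> bool list \<Rightarrow> nat option \<Rightarrow> real" where
  "rac_PYX \<delta> xs y = (case y of None \<Rightarrow> \<delta>
       | Some s \<Rightarrow> (if s = length (filter id xs) then 1 - \<delta> else 0))"

definition rac_PY :: "nat \<Rightarrow> real \<Rightarrow> (nat \<Rightarrow> real) \<Rightarrow> nat option \<Rightarrow> real" where
  "rac_PY k \<delta> p y = (\<Sum>xs\<in>rac_inputs k. rac_PX p xs * rac_PYX \<delta> xs y)"

definition rac_idens :: "nat \<Rightarrow> real \<Rightarrow> (nat \<Rightarrow> real) \<Rightarrow> bool list \<Rightarrow> nat option \<Rightarrow> real" where
  "rac_idens k \<delta> p xs y = ln (rac_PYX \<delta> xs y / rac_PY k \<delta> p y)"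

definition rac_MI :: "nat \<Rightarrow> real \<Rightarrow> (nat \<Rightarrow> real) \<Rightarrow> real" where
  "rac_MI k \<delta> p = (\<Sum>xs\<in>rac_inputs k. \<Sum>y\<in>rac_outputs k.
      rac_PX p xs * rac_PYX \<delta> xs y * rac_idens k \<delta> p xs y)"

definition rac_V :: "nat \<Rightarrow> real \<Rightarrow> (nat \<Rightarrow> real) \<Rightarrow> real" where
  "rac_V k \<delta> p = (\<Sum>xs\<in>rac_inputs k. \<Sum>y\<in>rac_outputs k.
      rac_PX p xs * rac_PYX \<delta> xs y * (rac_idens k \<delta> p xs y - rac_MI k \<delta> p)\<^sup>2)"

end

theory Submission
  imports Defs "HOL-Computational_Algebra.Polynomial" "HOL-Real_Asymp.Real_Asymp"
begin

text \<open>
  The erasures only contribute the factor 1 - \<delta>, so everything reduces to the entropy and the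
  varentropy of S = X_1 + ... + X_k.

  \<^emph>\<open>Maximisation.\<close> Moving two success probabilities towards each other at fixed sum increases
  their product and changes the law of S by a multiple of a second difference; since S has a
  log-concave law, Gibbs' inequality shows that the entropy does not decrease. Hence all
  probabilities may be replaced by their mean x. The entropy of Bin(k, x) equals
  A(x) + A(1 - x) - ln k! with A(x) = E ln S! - k x ln x, and A is concave because
  E 1/(S' + 1) \<le> 1/((k-1) x) for S' distributed as Bin(k-2, x); so x = 1/2 is optimal.

  \<^emph>\<open>Asymptotics.\<close> With v = (2s - n)^2/n, Stirling's formula up to the term 1/(12m) gives
  -ln P(S = s) = ln(\<pi>n/2)/2 + Q(v) + R, where Q is a polynomial in v and 1/n and
  |R| \<le> C (1 + v^4)/n^3 for \<^emph>\<open>all\<close> s: away from the centre v is at least of order n, so that a crude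
  bound of order n on R is enough. As v has bounded moments under Bin(n, 1/2), mean and variance
  are computed from the exact moments of v up to O(n^-3).
\<close>

section \<open>Reduction to the law of the sum\<close>

text \<open>Cross entropy against a fixed law is linear in the other law, so Gibbs' inequality
  reduces one exchange of probabilities to the sign of a second difference of ln P(S = s); no
  derivative of the entropy occurs. The argument takes logarithms of all these probabilities, so it
  runs with parameters strictly between 0 and 1, and the values 0 and 1 are reached at the end by
  continuity of x ln x.

  In the asymptotics the powers are tied together. An error n^-3 in the mean calls for the term
  1/(12m) in Stirling's formula and for Q up to 1/n^2. The squared remainder has weight (1 + v)^8,
  hence the eighth-power moment bound. The square of Q, truncated after 1/n^2, reaches v^4, hence
  the exact centred moments up to order eight. A bound on R at every s avoids estimates of binomial
  tails.

  The density is 0 on an erasure, whereas its mean is (1 - \<delta>) H with H the entropy of S. So V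
  equals (1 - \<delta>) (Var + \<delta> H^2) with Var the variance of -ln P(S = s); the squared
  logarithm in V and the factor ln k in its error both come from H^2.\<close>

text \<open>Coefficient s is the probability that the inputs in A sum to s.\<close>

definition adder_gf :: "(nat \<Rightarrow> real) \<Rightarrow> nat set \<Rightarrow> real poly" where
  "adder_gf p A = (\<Prod>i\<in>A. [:1 - p i, p i:])"

definition coeff_entropy :: "nat \<Rightarrow> real poly \<Rightarrow> real" where
  "coeff_entropy k F = - (\<Sum>s\<le>k. coeff F s * ln (coeff F s))"

lemma coeff_linear_mult_Suc:
  "coeff ([:a, b:] * F) (Suc s) = a * coeff F (Suc s) + b * coeff F s"
  for a b :: "'a::comm_semiring_1"
  by simp

lemma coeff_linear_mult_0: "coeff ([:a, b:] * F) 0 = a * coeff F 0"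
  for a b :: "'a::comm_semiring_1"
  by simp

text \<open>For a = 1 - p and b = p this is conditioning on one further independent Bernoulli input.
  With g arbitrary, the same rule serves the law of the sum, the cross entropies and the recursion
  for binomial means.\<close>

lemma sum_coeff_linear_mult:
  fixes a b :: "'a::comm_ring_1"
  assumes "degree F \<le> k"
  shows "(\<Sum>s\<le>Suc k. coeff ([:a, b:] * F) s * g s)
    = a * (\<Sum>s\<le>k. coeff F s * g s) + b * (\<Sum>s\<le>k. coeff F s * g (Suc s))"
proof -
  have z: "coeff F (Suc k) = 0"
    using assms by (intro coeff_eq_0) simp
  have "(\<Sum>s\<le>Suc k. coeff ([:a, b:] * F) s * g s)
      = a * coeff F 0 * g 0 + (\<Sum>s\<le>k. (a * coeff F (Suc s) + b * coeff F s) * g (Suc s))"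
    by (simp only: sum.atMost_Suc_shift coeff_linear_mult_0 coeff_linear_mult_Suc)
  also have "\<dots> = a * (coeff F 0 * g 0 + (\<Sum>s\<le>k. coeff F (Suc s) * g (Suc s)))
      + b * (\<Sum>s\<le>k. coeff F s * g (Suc s))"
    by (simp add: algebra_simps sum.distrib sum_distrib_left)
  also have "coeff F 0 * g 0 + (\<Sum>s\<le>k. coeff F (Suc s) * g (Suc s)) = (\<Sum>s\<le>Suc k. coeff F s * g s)"
    by (simp only: sum.atMost_Suc_shift)
  also have "\<dots> = (\<Sum>s\<le>k. coeff F s * g s)"
    using z by simp
  finally show ?thesis .
qed

lemma degree_adder_gf: "finite A \<Longrightarrow> degree (adder_gf p A) \<le> card A"
proof -
  assume "finite A"
  then have "degree (adder_gf p A) \<le> (\<Sum>i\<in>A. degree [:1 - p i, p i:])"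
    unfolding adder_gf_def using degree_prod_sum_le[of A "\<lambda>i. [:1 - p i, p i:]"] by (simp add: o_def)
  also have "\<dots> \<le> (\<Sum>i\<in>A. 1)"
    by (intro sum_mono) simp
  finally show ?thesis by simp
qed

text \<open>The total mass is the value of the polynomial at 1, where each factor equals 1.\<close>

lemma sum_coeff_adder_gf:
  assumes "finite A" "card A \<le> k"
  shows "(\<Sum>s\<le>k. coeff (adder_gf p A) s) = 1"
proof -
  have "(\<Sum>s\<le>k. coeff (adder_gf p A) s) = poly (adder_gf p A) 1"
    using degree_adder_gf[OF assms(1), of p] assms(2)
    by (simp add: poly_altdef) (intro sum.mono_neutral_right, auto intro: coeff_eq_0)
  then show ?thesis by (simp add: adder_gf_def poly_prod)
qed

lemma rac_inputs_Suc: "rac_inputs (Suc k) = (#) True ` rac_inputs k \<union> (#) False ` rac_inputs k"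
proof (rule set_eqI)
  fix xs :: "bool list"
  show "xs \<in> rac_inputs (Suc k) \<longleftrightarrow> xs \<in> (#) True ` rac_inputs k \<union> (#) False ` rac_inputs k"
    by (cases xs) (auto simp: rac_inputs_def)
qed

lemma finite_rac_inputs: "finite (rac_inputs k)"
  by (induction k) (simp_all add: rac_inputs_Suc, simp add: rac_inputs_def)

lemma rac_PX_Cons: "rac_PX p (x # xs) = (if x then p 0 else 1 - p 0) * rac_PX (p \<circ> Suc) xs"
  unfolding rac_PX_def by (simp add: prod.lessThan_Suc_shift o_def cong: if_cong del: prod.lessThan_Suc)

lemma adder_gf_Suc: "adder_gf p {..<Suc k} = [:1 - p 0, p 0:] * adder_gf (p \<circ> Suc) {..<k}"
  unfolding adder_gf_def by (simp add: prod.lessThan_Suc_shift del: prod.lessThan_Suc)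

text \<open>Peeling off the head of the list shifts the parameters to \<open>p \<circ> Suc\<close>
  and, when the head is \<open>True\<close>, also the argument of g; hence the induction runs over
  all p and g.\<close>

lemma sum_rac_inputs:
  "(\<Sum>xs\<in>rac_inputs k. rac_PX p xs * g (length (filter id xs)))
    = (\<Sum>s\<le>k. coeff (adder_gf p {..<k}) s * g s)"
proof (induction k arbitrary: p g)
  case 0
  show ?case by (simp add: rac_inputs_def rac_PX_def adder_gf_def)
next
  case (Suc k)
  have "(\<Sum>xs\<in>rac_inputs (Suc k). rac_PX p xs * g (length (filter id xs)))
      = (\<Sum>xs\<in>rac_inputs k. rac_PX p (True # xs) * g (length (filter id (True # xs))))
      + (\<Sum>xs\<in>rac_inputs k. rac_PX p (False # xs) * g (length (filter id (False # xs))))"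
    unfolding rac_inputs_Suc
    by (subst sum.union_disjoint) (auto simp: finite_rac_inputs sum.reindex)
  also have "\<dots> = p 0 * (\<Sum>xs\<in>rac_inputs k. rac_PX (p \<circ> Suc) xs * g (Suc (length (filter id xs))))
      + (1 - p 0) * (\<Sum>xs\<in>rac_inputs k. rac_PX (p \<circ> Suc) xs * g (length (filter id xs)))"
    by (simp add: rac_PX_Cons sum_distrib_left mult.assoc)
  also have "\<dots> = (\<Sum>s\<le>Suc k. coeff (adder_gf p {..<Suc k}) s * g s)"
    using degree_adder_gf[of "{..<k}" "p \<circ> Suc"]
    by (simp only: Suc.IH Suc.IH[of _ "\<lambda>s. g (Suc s)"] adder_gf_Suc sum_coeff_linear_mult
        finite_lessThan card_lessThan True_implies_equals add.commute)
  finally show ?case .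
qed

lemma rac_PY_Some:
  assumes "s \<le> k"
  shows "rac_PY k \<delta> p (Some s) = (1 - \<delta>) * coeff (adder_gf p {..<k}) s"
proof -
  have "rac_PY k \<delta> p (Some s) = (\<Sum>t\<le>k. coeff (adder_gf p {..<k}) t * (if s = t then 1 - \<delta> else 0))"
    using sum_rac_inputs[of p "\<lambda>t. if s = t then 1 - \<delta> else 0" k]
    by (simp add: rac_PY_def rac_PYX_def)
  then show ?thesis using assms by (simp add: if_distrib sum.delta' cong: if_cong)
qed

lemma rac_PY_None: "rac_PY k \<delta> p None = \<delta>"
  using sum_rac_inputs[of p "\<lambda>_. \<delta>" k] sum_coeff_adder_gf[of "{..<k}" k p]
  by (simp add: rac_PY_def rac_PYX_def sum_distrib_right[symmetric])

lemma length_filter_rac_inputs: "xs \<in> rac_inputs k \<Longrightarrow> length (filter id xs) \<le> k"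
  by (auto simp: rac_inputs_def)

text \<open>At \<delta> = 0 the quotient is 0 / 0, and the conventions x / 0 = 0 and ln 0 = 0 give
  the same value as ln 1.\<close>

lemma rac_idens_None: "rac_idens k \<delta> p xs None = 0"
  by (simp add: rac_idens_def rac_PYX_def rac_PY_None)

lemma rac_idens_Some:
  assumes "xs \<in> rac_inputs k" "\<delta> \<noteq> 1"
  shows "rac_idens k \<delta> p xs (Some (length (filter id xs)))
    = - ln (coeff (adder_gf p {..<k}) (length (filter id xs)))"
  using assms length_filter_rac_inputs[OF assms(1)]
  by (simp add: rac_idens_def rac_PYX_def rac_PY_Some ln_inverse flip: inverse_eq_divide)

text \<open>The density is 0 on an erasure and otherwise depends on the inputs only through their
  sum. The identity as h gives the mutual information, a centred square gives the variance.\<close>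

lemma rac_expectation:
  "(\<Sum>xs\<in>rac_inputs k. \<Sum>y\<in>rac_outputs k. rac_PX p xs * rac_PYX \<delta> xs y * h (rac_idens k \<delta> p xs y))
    = \<delta> * h 0 + (1 - \<delta>) * (\<Sum>s\<le>k. coeff (adder_gf p {..<k}) s * h (- ln (coeff (adder_gf p {..<k}) s)))"
proof -
  let ?f = "coeff (adder_gf p {..<k})"
  have "(\<Sum>y\<in>rac_outputs k. rac_PX p xs * rac_PYX \<delta> xs y * h (rac_idens k \<delta> p xs y))
      = rac_PX p xs * (\<delta> * h 0 + (1 - \<delta>) * h (- ln (?f (length (filter id xs)))))"
    (is "?l = ?r") if xs: "xs \<in> rac_inputs k" for xs
  proof -
    let ?m = "length (filter id xs)"
    have m: "?m \<le> k" using length_filter_rac_inputs[OF xs] .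
    have "?l = rac_PX p xs * \<delta> * h 0
        + (\<Sum>s\<in>{0..k}. rac_PX p xs * rac_PYX \<delta> xs (Some s) * h (rac_idens k \<delta> p xs (Some s)))"
      unfolding rac_outputs_def
      by (subst sum.insert) (auto simp: rac_idens_None rac_PYX_def sum.reindex)
    also have "(\<Sum>s\<in>{0..k}. rac_PX p xs * rac_PYX \<delta> xs (Some s) * h (rac_idens k \<delta> p xs (Some s)))
        = (\<Sum>s\<in>{0..k}. if s = ?m then rac_PX p xs * (1 - \<delta>) * h (rac_idens k \<delta> p xs (Some ?m)) else 0)"
      by (intro sum.cong) (auto simp: rac_PYX_def)
    also have "\<dots> = rac_PX p xs * (1 - \<delta>) * h (rac_idens k \<delta> p xs (Some ?m))"
      using m by simp
    also have "\<dots> = rac_PX p xs * (1 - \<delta>) * h (- ln (?f ?m))"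
      \<comment> \<open>At \<delta> = 1 the density may differ from this form, but the weight 1 -
        \<delta> vanishes.\<close>
      using rac_idens_Some[OF xs] by (cases "\<delta> = 1") auto
    finally show ?thesis by (simp add: algebra_simps)
  qed
  then have "(\<Sum>xs\<in>rac_inputs k. \<Sum>y\<in>rac_outputs k. rac_PX p xs * rac_PYX \<delta> xs y * h (rac_idens k \<delta> p xs y))
      = (\<Sum>s\<le>k. ?f s * (\<delta> * h 0 + (1 - \<delta>) * h (- ln (?f s))))"
    using sum_rac_inputs[of p "\<lambda>s. \<delta> * h 0 + (1 - \<delta>) * h (- ln (?f s))" k] by simp
  also have "\<dots> = \<delta> * h 0 * (\<Sum>s\<le>k. ?f s) + (1 - \<delta>) * (\<Sum>s\<le>k. ?f s * h (- ln (?f s)))"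
    by (simp add: algebra_simps sum.distrib sum_distrib_left sum_subtractf)
  finally show ?thesis using sum_coeff_adder_gf[of "{..<k}" k p] by simp
qed

lemma rac_MI_eq: "rac_MI k \<delta> p = (1 - \<delta>) * coeff_entropy k (adder_gf p {..<k})"
  unfolding rac_MI_def coeff_entropy_def
  using rac_expectation[of p \<delta> "\<lambda>x. x" k] by (simp add: sum_negf)

text \<open>The erasure atom at 0 lies at distance M = (1 - \<delta>) H from the mean. Its
  contribution \<delta> M^2 is why H^2 is subtracted only with the coefficient 1 - \<delta>, which
  later leaves \<delta> H^2 beside the variance of the surprise.\<close>

lemma rac_V_eq:
  "rac_V k \<delta> p = (1 - \<delta>) *
    ((\<Sum>s\<le>k. coeff (adder_gf p {..<k}) s * (ln (coeff (adder_gf p {..<k}) s))\<^sup>2)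
      - (1 - \<delta>) * (coeff_entropy k (adder_gf p {..<k}))\<^sup>2)"
proof -
  let ?f = "coeff (adder_gf p {..<k})"
  define M where "M = rac_MI k \<delta> p"
  define H where "H = coeff_entropy k (adder_gf p {..<k})"
  have M: "M = (1 - \<delta>) * H" by (simp add: M_def H_def rac_MI_eq)
  have "rac_V k \<delta> p = \<delta> * M\<^sup>2 + (1 - \<delta>) * (\<Sum>s\<le>k. ?f s * (- ln (?f s) - M)\<^sup>2)"
    unfolding rac_V_def M_def[symmetric]
    using rac_expectation[of p \<delta> "\<lambda>x. (x - M)\<^sup>2" k] by simp
  also have "(\<Sum>s\<le>k. ?f s * (- ln (?f s) - M)\<^sup>2)
      = (\<Sum>s\<le>k. ?f s * (ln (?f s))\<^sup>2 + 2 * M * (?f s * ln (?f s)) + M\<^sup>2 * ?f s)"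
    by (intro sum.cong refl) (simp add: power2_eq_square algebra_simps)
  also have "\<dots> = (\<Sum>s\<le>k. ?f s * (ln (?f s))\<^sup>2) - 2 * M * H + M\<^sup>2"
    using sum_coeff_adder_gf[of "{..<k}" k p]
    by (simp add: sum.distrib sum_distrib_left[symmetric] H_def coeff_entropy_def)
  finally show ?thesis
    unfolding H_def[symmetric] M by (simp add: power2_eq_square algebra_simps)
qed

section \<open>Equalising the success probabilities\<close>

text \<open>This form, rather than f (s - 1) * f (s + 1) \<le> f s ^ 2, is stable under multiplication by
  linear factors without any assumption on the zeros of f.\<close>

definition log_concave :: "(nat \<Rightarrow> real) \<Rightarrow> bool" where
  "log_concave f \<longleftrightarrow> (\<forall>i j. i \<le> j \<longrightarrow> f i * f (Suc j) \<le> f (Suc i) * f j)"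

text \<open>Expand the difference of the two sides in a and b. The a^2 and b^2 terms are instances
  of the hypothesis; in the ab term the two copies of f i * f j cancel and leave a comparison of
  indices one further apart.\<close>

lemma log_concave_linear_mult:
  assumes lc: "log_concave (coeff F)" and nn: "\<And>s. 0 \<le> coeff F s" and ab: "0 \<le> a" "0 \<le> b"
  shows "log_concave (coeff ([:a, b:] * F))"
  unfolding log_concave_def
proof (intro allI impI)
  fix i j :: nat
  assume "i \<le> j"
  let ?f = "coeff F" and ?g = "coeff ([:a, b:] * F)"
  have L: "?f i * ?f (Suc j) \<le> ?f (Suc i) * ?f j" if "i \<le> j" for i j
    using lc that by (auto simp: log_concave_def)
  show "?g i * ?g (Suc j) \<le> ?g (Suc i) * ?g j"
  proof (cases i)
    case 0
    show ?thesis
    proof (cases j)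
      case 0
      then show ?thesis using \<open>i = 0\<close> by (simp add: mult.commute)
    next
      case (Suc m)
      have "0 \<le> a * a * (?f 1 * ?f (Suc m) - ?f 0 * ?f (Suc (Suc m)))
          + a * b * (?f 1 * ?f m) + b * b * (?f 0 * ?f m)"
        using ab nn L[of 0 "Suc m"] by (intro add_nonneg_nonneg mult_nonneg_nonneg) auto
      then show ?thesis
        unfolding \<open>i = 0\<close> Suc coeff_linear_mult_Suc coeff_linear_mult_0 by (simp add: algebra_simps)
    qed
  next
    case (Suc l)
    then obtain m where j: "j = Suc m" and lm: "l \<le> m"
      using \<open>i \<le> j\<close> by (cases j) auto
    \<comment> \<open>Two instances of the hypothesis chained through f (l + 1) * f (m + 1); for l =
      m the two products coincide.\<close>
    have mid: "0 \<le> ?f (Suc (Suc l)) * ?f m - ?f l * ?f (Suc (Suc m))"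
    proof (cases "l = m")
      case False
      then have "Suc l \<le> m" using lm by simp
      then show ?thesis using L[of "Suc l" m] L[of l "Suc m"] by (simp add: algebra_simps)
    qed (simp add: mult.commute)
    have "0 \<le> a * a * (?f (Suc (Suc l)) * ?f (Suc m) - ?f (Suc l) * ?f (Suc (Suc m)))
        + b * b * (?f (Suc l) * ?f m - ?f l * ?f (Suc m))
        + a * b * (?f (Suc (Suc l)) * ?f m - ?f l * ?f (Suc (Suc m)))"
      using ab mid L[of "Suc l" "Suc m"] L[of l m] lm
      by (intro add_nonneg_nonneg mult_nonneg_nonneg) auto
    then show ?thesis
      unfolding Suc j coeff_linear_mult_Suc by (simp add: algebra_simps)
  qed
qed

lemma coeff_adder_gf_nonneg:
  assumes "finite A" "\<And>i. i \<in> A \<Longrightarrow> 0 \<le> p i \<and> p i \<le> 1"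
  shows "0 \<le> coeff (adder_gf p A) s"
  using assms
proof (induction A arbitrary: s rule: finite_induct)
  case (insert i A)
  then show ?case
    by (cases s) (auto simp: adder_gf_def intro!: add_nonneg_nonneg mult_nonneg_nonneg)
qed (simp add: adder_gf_def coeff_1)

lemma coeff_adder_gf_pos:
  assumes "finite A" "\<And>i. i \<in> A \<Longrightarrow> 0 < p i \<and> p i < 1" "s \<le> card A"
  shows "0 < coeff (adder_gf p A) s"
  using assms
proof (induction A arbitrary: s rule: finite_induct)
  case (insert i A)
  have nn: "0 \<le> coeff (adder_gf p A) t" for t
    using insert.hyps(1) insert.prems(1) by (intro coeff_adder_gf_nonneg) (auto simp: less_imp_le)
  have eq: "adder_gf p (insert i A) = [:1 - p i, p i:] * adder_gf p A"
    using insert.hyps by (simp add: adder_gf_def)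
  have i: "0 < p i" "0 < 1 - p i" using insert.prems(1)[of i] by auto
  show ?case
  proof (cases s)
    case 0
    then show ?thesis using insert.IH[of 0] insert.prems(1) i
      unfolding eq 0 coeff_linear_mult_0 by auto
  next
    case (Suc t)
    then have "0 < coeff (adder_gf p A) t"
      using insert.prems insert.hyps by (intro insert.IH) auto
    then show ?thesis using i nn
      unfolding eq Suc coeff_linear_mult_Suc
      by (intro add_nonneg_pos mult_nonneg_nonneg mult_pos_pos) auto
  qed
qed (simp add: adder_gf_def coeff_1)

lemma log_concave_adder_gf:
  assumes "finite A" "\<And>i. i \<in> A \<Longrightarrow> 0 \<le> p i \<and> p i \<le> 1"
  shows "log_concave (coeff (adder_gf p A))"
  using assms
proof (induction A rule: finite_induct)
  case (insert i A)
  have eq: "adder_gf p (insert i A) = [:1 - p i, p i:] * adder_gf p A"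
    using insert.hyps by (simp add: adder_gf_def)
  show ?case
    unfolding eq using insert.prems insert.hyps
    by (intro log_concave_linear_mult insert.IH coeff_adder_gf_nonneg) auto
qed (simp add: adder_gf_def log_concave_def coeff_1)

text \<open>Gibbs' inequality: sum ln y \<le> y - 1 at y = f s / q s, weighted by q s. Where q s =
  0, the termwise bound reads 0 \<le> f s.\<close>

lemma entropy_le_cross_entropy:
  fixes q f :: "'a \<Rightarrow> real"
  assumes "\<And>s. s \<in> A \<Longrightarrow> 0 \<le> q s" "\<And>s. s \<in> A \<Longrightarrow> 0 < f s" "sum f A \<le> sum q A"
  shows "- (\<Sum>s\<in>A. q s * ln (q s)) \<le> - (\<Sum>s\<in>A. q s * ln (f s))"
proof -
  have "q s * ln (f s) - q s * ln (q s) \<le> f s - q s" if "s \<in> A" for s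
  proof (cases "q s = 0")
    case False
    then have q: "0 < q s" using assms(1)[OF that] by simp
    have f: "0 < f s" using assms(2)[OF that] .
    have "ln (f s) - ln (q s) = ln (f s / q s)" using q f by (simp add: ln_div)
    also have "\<dots> \<le> f s / q s - 1" using q f by (intro ln_le_minus_one) simp
    finally have "q s * (ln (f s) - ln (q s)) \<le> q s * (f s / q s - 1)"
      using q by (intro mult_left_mono) auto
    then show ?thesis using q by (simp add: algebra_simps)
  qed (use assms(2)[OF that] in simp)
  then have "(\<Sum>s\<in>A. q s * ln (f s) - q s * ln (q s)) \<le> (\<Sum>s\<in>A. f s - q s)"
    by (rule sum_mono)
  then show ?thesis using assms(3) by (simp add: sum_subtractf)
qed

text \<open>W stands for the law of the remaining inputs. The entropy of F is compared with its
  cross entropy against the more balanced law G, so the logarithms and the log-concavity are those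
  of G, while F may have zero coefficients.\<close>

lemma coeff_entropy_equalise:
  assumes W: "degree W \<le> k" "\<And>s. 0 \<le> coeff W s"
    and F: "F = [:1 - a, a:] * ([:1 - b, b:] * W)" and G: "G = [:1 - c, c:] * ([:1 - d, d:] * W)"
    and ab: "c + d = a + b" "a * b \<le> c * d"
    and Gpos: "\<And>s. s \<le> Suc (Suc k) \<Longrightarrow> 0 < coeff G s" and Glc: "log_concave (coeff G)"
    and Fnn: "\<And>s. 0 \<le> coeff F s"
  shows "coeff_entropy (Suc (Suc k)) F \<le> coeff_entropy (Suc (Suc k)) G"
proof -
  define w where "w g = (\<Sum>s\<le>k. coeff W s * g s)" for g :: "nat \<Rightarrow> real"
  have deg: "degree ([:1 - y, y:] * W) \<le> Suc k" for y :: real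
    using degree_mult_le[of "[:1 - y, y:]" W] W(1) by (simp split: if_splits)
  \<comment> \<open>The law depends on x and y only through x + y and x * y, and the product
    multiplies a second difference. With equal sums, F and G differ in that term alone.\<close>
  have expand: "(\<Sum>s\<le>Suc (Suc k). coeff ([:1 - x, x:] * ([:1 - y, y:] * W)) s * g s)
      = (1 - (x + y)) * w g + (x + y) * w (\<lambda>s. g (Suc s))
        + x * y * w (\<lambda>s. g s - 2 * g (Suc s) + g (Suc (Suc s)))" for x y g
    unfolding sum_coeff_linear_mult[OF deg] sum_coeff_linear_mult[OF W(1)] w_def
    by (simp add: algebra_simps sum.distrib sum_subtractf sum_distrib_left)
  have tot: "(\<Sum>s\<le>Suc (Suc k). coeff ([:1 - x, x:] * ([:1 - y, y:] * W)) s) = w (\<lambda>_. 1)" for x y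
    using expand[of x y "\<lambda>_. 1"] by (simp add: w_def algebra_simps)
  define l where "l s = ln (coeff G s)" for s
  have "l s - 2 * l (Suc s) + l (Suc (Suc s)) \<le> 0" if "s \<le> k" for s
  proof -
    have "coeff G s * coeff G (Suc (Suc s)) \<le> coeff G (Suc s) * coeff G (Suc s)"
      using Glc by (simp add: log_concave_def)
    then have "ln (coeff G s * coeff G (Suc (Suc s))) \<le> ln (coeff G (Suc s) * coeff G (Suc s))"
      using Gpos that by (subst ln_le_cancel_iff) auto
    then show ?thesis
      using that Gpos[of s] Gpos[of "Suc s"] Gpos[of "Suc (Suc s)"] by (simp add: l_def ln_mult)
  qed
  then have neg: "w (\<lambda>s. l s - 2 * l (Suc s) + l (Suc (Suc s))) \<le> 0"
    unfolding w_def using W(2) by (intro sum_nonpos mult_nonneg_nonpos) auto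
  have "coeff_entropy (Suc (Suc k)) F \<le> - (\<Sum>s\<le>Suc (Suc k). coeff F s * l s)"
    unfolding coeff_entropy_def l_def using Fnn Gpos tot
    by (intro entropy_le_cross_entropy) (auto simp: F G)
  also have "\<dots> = - (\<Sum>s\<le>Suc (Suc k). coeff G s * l s)
      + (c * d - a * b) * w (\<lambda>s. l s - 2 * l (Suc s) + l (Suc (Suc s)))"
    unfolding F G expand ab(1) by (simp add: algebra_simps)
  also have "\<dots> \<le> - (\<Sum>s\<le>Suc (Suc k). coeff G s * l s)"
    using neg ab(2) by (simp add: mult_nonneg_nonpos)
  also have "\<dots> = coeff_entropy (Suc (Suc k)) G"
    by (simp add: coeff_entropy_def l_def)
  finally show ?thesis .
qed

text \<open>Each exchange moves one parameter exactly to m and passes its deviation to a parameter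
  on the other side of m. The number of parameters different from m drops, so finitely many
  exchanges suffice.\<close>

lemma coeff_entropy_le_mean:
  assumes "\<And>i. i < k \<Longrightarrow> 0 < p i \<and> p i < 1" and "(\<Sum>i<k. p i) = real k * m"
  shows "coeff_entropy k (adder_gf p {..<k}) \<le> coeff_entropy k (adder_gf (\<lambda>_. m) {..<k})"
  using assms
proof (induction "card {i. i < k \<and> p i \<noteq> m}" arbitrary: p rule: less_induct)
  case less
  show ?case
  proof (cases "\<forall>i<k. p i = m")
    case True
    then have "adder_gf p {..<k} = adder_gf (\<lambda>_. m) {..<k}"
      by (simp add: adder_gf_def)
    then show ?thesis by simp
  next
    case False
    have sum0: "(\<Sum>i<k. p i - m) = 0" using less.prems(2) by (simp add: sum_subtractf)
    \<comment> \<open>The deviations from m sum to 0, so deviations of one sign would all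
      vanish.\<close>
    have "\<exists>i<k. p i < m"
    proof (rule ccontr)
      assume "\<not> ?thesis"
      then have "\<forall>i\<in>{..<k}. p i - m = 0"
        using sum0 by (subst sum_nonneg_eq_0_iff[symmetric]) auto
      then show False using False by auto
    qed
    then obtain i where i: "i < k" "p i < m" by blast
    have "\<exists>j<k. m < p j"
    proof (rule ccontr)
      assume "\<not> ?thesis"
      moreover have "(\<Sum>i<k. m - p i) = 0" using less.prems(2) by (simp add: sum_subtractf)
      ultimately have "\<forall>i\<in>{..<k}. m - p i = 0"
        by (subst sum_nonneg_eq_0_iff[symmetric]) auto
      then show False using False by auto
    qed
    then obtain j where j: "j < k" "m < p j" by blast
    have ij: "i \<noteq> j" using i j by auto
    define A where "A = {..<k} - {i} - {j}"
    \<comment> \<open>The new value at j lies strictly between \<open>p i\<close> and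
      \<open>p j\<close>, hence still in the open unit interval.\<close>
    define q where "q = p(i := m, j := p i + p j - m)"
    have kA: "{..<k} = insert i (insert j A)" "i \<notin> insert j A" "j \<notin> A" "finite A"
      using i j ij by (auto simp: A_def)
    have "card {..<k} = Suc (Suc (card A))"
      unfolding kA(1) using kA(2-4) by simp
    then have k: "k = Suc (Suc (card A))" by simp
    have q01: "0 < q l \<and> q l < 1" if "l < k" for l
      using less.prems(1)[OF that] less.prems(1)[of i] less.prems(1)[of j] i j
      by (auto simp: q_def)
    have sumq: "(\<Sum>l<k. q l) = real k * m"
    proof -
      have eqA: "(\<Sum>l\<in>A. q l) = (\<Sum>l\<in>A. p l)"
        using kA by (intro sum.cong) (auto simp: q_def)
      have "(\<Sum>l<k. q l) = q i + (q j + (\<Sum>l\<in>A. p l))"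
        unfolding kA(1) using kA by (simp add: eqA)
      also have "\<dots> = (\<Sum>l<k. p l)"
        unfolding kA(1) using kA ij by (simp add: q_def)
      finally show ?thesis using less.prems(2) by simp
    qed
    have "card {l. l < k \<and> q l \<noteq> m} < card {l. l < k \<and> p l \<noteq> m}"
    proof (rule psubset_card_mono)
      show "{l. l < k \<and> q l \<noteq> m} \<subset> {l. l < k \<and> p l \<noteq> m}"
        using i j ij by (auto simp: q_def split: if_splits)
    qed simp
    then have IH: "coeff_entropy k (adder_gf q {..<k}) \<le> coeff_entropy k (adder_gf (\<lambda>_. m) {..<k})"
      using q01 sumq by (intro less.hyps) auto
    have Aq: "adder_gf q A = adder_gf p A"
      unfolding adder_gf_def using kA by (intro prod.cong) (auto simp: q_def)
    have fac: "adder_gf r {..<k} = [:1 - r i, r i:] * ([:1 - r j, r j:] * adder_gf r A)" for r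
      unfolding adder_gf_def kA(1) using kA by (simp del: mult_pCons_left)
    have "coeff_entropy (Suc (Suc (card A))) (adder_gf p {..<k})
        \<le> coeff_entropy (Suc (Suc (card A))) (adder_gf q {..<k})"
    proof (rule coeff_entropy_equalise)
      show "adder_gf p {..<k} = [:1 - p i, p i:] * ([:1 - p j, p j:] * adder_gf p A)"
        by (rule fac)
      show "adder_gf q {..<k} = [:1 - m, m:] * ([:1 - (p i + p j - m), p i + p j - m:] * adder_gf p A)"
        unfolding fac Aq using ij by (simp add: q_def del: mult_pCons_left)
      \<comment> \<open>This product equals the gain
        \<open>m * (p i + p j - m) - p i * p j\<close>.\<close>
      have "0 \<le> (m - p i) * (p j - m)" using i j by simp
      then show "p i * p j \<le> m * (p i + p j - m)" by (simp add: algebra_simps)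
      show "log_concave (coeff (adder_gf q {..<k}))"
        using q01 by (intro log_concave_adder_gf) (auto simp: less_imp_le)
      show "0 < coeff (adder_gf q {..<k}) s" if "s \<le> Suc (Suc (card A))" for s
        using that q01 by (intro coeff_adder_gf_pos) (auto simp: k)
      show "0 \<le> coeff (adder_gf p {..<k}) s" for s
        using less.prems(1) by (intro coeff_adder_gf_nonneg) (auto simp: less_imp_le)
      show "0 \<le> coeff (adder_gf p A) s" for s
        using less.prems(1) by (intro coeff_adder_gf_nonneg) (auto simp: less_imp_le A_def)
    qed (use degree_adder_gf kA in auto)
    then show ?thesis using IH k by simp
  qed
qed

section \<open>Binomial means and the entropy of the binomial law\<close>

definition binomial_mean :: "nat \<Rightarrow> real \<Rightarrow> (nat \<Rightarrow> real) \<Rightarrow> real" where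
  "binomial_mean n x c = (\<Sum>s\<le>n. Bernstein n s x * c s)"

lemma coeff_adder_gf_const:
  assumes "s \<le> k"
  shows "coeff (adder_gf (\<lambda>_. x) {..<k}) s = Bernstein k s x"
  using assms by (simp add: adder_gf_def coeff_linear_poly_power Bernstein_def)

lemma binomial_mean_eq_coeff:
  "binomial_mean n x c = (\<Sum>s\<le>n. coeff (adder_gf (\<lambda>_. x) {..<n}) s * c s)"
  unfolding binomial_mean_def by (intro sum.cong) (simp_all add: coeff_adder_gf_const)

lemma binomial_mean_0: "binomial_mean 0 x c = c 0"
  by (simp add: binomial_mean_def Bernstein_def)

lemma binomial_mean_Suc:
  "binomial_mean (Suc n) x c = (1 - x) * binomial_mean n x c + x * binomial_mean n x (\<lambda>s. c (Suc s))"
  using sum_coeff_linear_mult[of "adder_gf (\<lambda>_. x) {..<n}" n "1 - x" x c]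
    degree_adder_gf[of "{..<n}" "\<lambda>_. x"] adder_gf_Suc[of "\<lambda>_. x" n]
  by (simp add: binomial_mean_eq_coeff o_def del: sum.atMost_Suc mult_pCons_left)

lemma binomial_mean_add:
  "binomial_mean n x (\<lambda>s. c s + d s) = binomial_mean n x c + binomial_mean n x d"
  by (simp add: binomial_mean_def algebra_simps sum.distrib)

lemma binomial_mean_diff:
  "binomial_mean n x (\<lambda>s. c s - d s) = binomial_mean n x c - binomial_mean n x d"
  by (simp add: binomial_mean_def algebra_simps sum_subtractf)

lemma binomial_mean_cmult: "binomial_mean n x (\<lambda>s. a * c s) = a * binomial_mean n x c"
  by (simp add: binomial_mean_def algebra_simps sum_distrib_left)

lemma binomial_mean_const: "binomial_mean n x (\<lambda>_. a) = a"
  by (simp add: binomial_mean_def sum_distrib_right[symmetric])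

lemma binomial_mean_mono:
  assumes "0 \<le> x" "x \<le> 1" "\<And>s. s \<le> n \<Longrightarrow> c s \<le> d s"
  shows "binomial_mean n x c \<le> binomial_mean n x d"
  unfolding binomial_mean_def using assms by (intro sum_mono mult_left_mono Bernstein_nonneg) auto

text \<open>If S has law Bin(n, x), then n - S has law Bin(n, 1 - x). This turns the ln (n - s)! in
  the surprise into a copy of the ln s! term at 1 - x.\<close>

lemma binomial_mean_reflect: "binomial_mean n x (\<lambda>s. c (n - s)) = binomial_mean n (1 - x) c"
proof -
  have "Bernstein n (n - s) (1 - x) = Bernstein n s x" if "s \<le> n" for s
    using that binomial_symmetric[OF that] by (simp add: Bernstein_def)
  then show ?thesis
    unfolding binomial_mean_def
    by (intro sum.reindex_bij_witness[of _ "\<lambda>s. n - s" "\<lambda>s. n - s"]) auto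
qed

lemma binomial_mean_real: "binomial_mean n x real = real n * x"
  unfolding binomial_mean_def using sum_k_Bernstein[of n x] by (simp add: mult.commute)

text \<open>The two branches of the recursion in n differ by a unit shift of c, so a derivative in x
  becomes a forward difference in s with one trial fewer.\<close>

lemma DERIV_binomial_mean:
  "((\<lambda>x. binomial_mean n x c) has_real_derivative
     real n * binomial_mean (n - 1) x (\<lambda>s. c (Suc s) - c s)) (at x)"
proof (induction n arbitrary: c)
  case 0
  show ?case by (simp add: binomial_mean_0)
next
  case (Suc n)
  have "((\<lambda>x. (1 - x) * binomial_mean n x c + x * binomial_mean n x (\<lambda>s. c (Suc s))) has_real_derivative
      binomial_mean n x (\<lambda>s. c (Suc s)) - binomial_mean n x c
      + real n * ((1 - x) * binomial_mean (n - 1) x (\<lambda>s. c (Suc s) - c s)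
        + x * binomial_mean (n - 1) x (\<lambda>s. c (Suc (Suc s)) - c (Suc s)))) (at x)"
    by (rule derivative_eq_intros Suc.IH refl)+ (simp add: algebra_simps)
  \<comment> \<open>The recursion recombines n - 1 trials into n; for n = 0, where n - 1 is
    truncated, the factor \<open>real n\<close> is 0.\<close>
  also have "real n * ((1 - x) * binomial_mean (n - 1) x (\<lambda>s. c (Suc s) - c s)
        + x * binomial_mean (n - 1) x (\<lambda>s. c (Suc (Suc s)) - c (Suc s)))
      = real n * binomial_mean n x (\<lambda>s. c (Suc s) - c s)"
    by (cases n) (simp_all add: binomial_mean_Suc)
  finally show ?case
    by (simp add: binomial_mean_Suc[abs_def] binomial_mean_diff algebra_simps)
qed

text \<open>By the absorption identity (n + 1) C(n, s) = (s + 1) C(n + 1, s + 1), the left side is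
  the probability that a Bin(n + 1, x) variable is nonzero.\<close>

lemma binomial_mean_inverse_Suc:
  assumes "0 < x" "x < 1"
  shows "real (Suc n) * x * binomial_mean n x (\<lambda>s. 1 / real (Suc s)) \<le> 1"
proof -
  have "real (Suc n) * x * (Bernstein n s x * (1 / real (Suc s))) = Bernstein (Suc n) (Suc s) x" for s
  proof -
    have "real (Suc s) * real (Suc n choose Suc s) = real (Suc n) * real (n choose s)"
      by (simp only: of_nat_mult[symmetric] Suc_times_binomial_eq mult.commute)
    then have "real (Suc n choose Suc s) = real (Suc n) * real (n choose s) / real (Suc s)"
      by (simp add: field_simps)
    then show ?thesis by (simp add: Bernstein_def mult_ac)
  qed
  then have "real (Suc n) * x * binomial_mean n x (\<lambda>s. 1 / real (Suc s)) = (\<Sum>s\<le>n. Bernstein (Suc n) (Suc s) x)"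
    by (simp only: binomial_mean_def sum_distrib_left)
  also have "\<dots> = 1 - Bernstein (Suc n) 0 x"
    using sum_Bernstein[of "Suc n" x] by (simp only: sum.atMost_Suc_shift)
  also have "\<dots> \<le> 1" using Bernstein_nonneg[of x "Suc n" 0] assms by simp
  finally show ?thesis .
qed

text \<open>This is one of the two summands A(x), A(1 - x) of the entropy. Two differences of ln s!
  give ln ((s + 2) / (s + 1)) \<le> 1 / (s + 1), and the mean of this bound is just small enough to
  be outweighed by the -k / x coming from -k x ln x.\<close>

lemma concave_on_binomial_entropy_half:
  "concave_on {0<..<1} (\<lambda>x. binomial_mean k x (\<lambda>s. ln (fact s)) - real k * (x * ln x))"
proof (rule f''_le0_imp_concave)
  fix x :: real
  assume x: "x \<in> {0<..<1}"
  have lnf: "ln (fact (Suc s) :: real) - ln (fact s) = ln (real (Suc s))" for s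
  proof -
    have "ln (fact (Suc s) :: real) = ln (real (Suc s)) + ln (fact s)"
      unfolding fact_Suc by (subst ln_mult) auto
    then show ?thesis by simp
  qed
  show "((\<lambda>x. binomial_mean k x (\<lambda>s. ln (fact s)) - real k * (x * ln x)) has_real_derivative
      real k * (binomial_mean (k - 1) x (\<lambda>s. ln (real (Suc s))) - (ln x + 1))) (at x)"
    using x by (auto intro!: derivative_eq_intros
        DERIV_binomial_mean[of k "\<lambda>s. ln (fact s)", unfolded lnf] simp: algebra_simps)
  show "((\<lambda>x. real k * (binomial_mean (k - 1) x (\<lambda>s. ln (real (Suc s))) - (ln x + 1))) has_real_derivative
      real k * (real (k - 1) * binomial_mean (k - 1 - 1) x (\<lambda>s. ln (real (Suc (Suc s))) - ln (real (Suc s)))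
        - 1 / x)) (at x)"
    using x by (auto intro!: derivative_eq_intros DERIV_binomial_mean simp: algebra_simps)
  have "real (k - 1) * binomial_mean (k - 1 - 1) x (\<lambda>s. ln (real (Suc (Suc s))) - ln (real (Suc s))) \<le> 1 / x"
  proof (cases "k - 1")
    case (Suc n)
    have "binomial_mean n x (\<lambda>s. ln (real (Suc (Suc s))) - ln (real (Suc s)))
        \<le> binomial_mean n x (\<lambda>s. 1 / real (Suc s))"
    proof (intro binomial_mean_mono)
      fix s :: nat
      have "ln (real (Suc (Suc s))) - ln (real (Suc s)) = ln (1 + 1 / real (Suc s))"
        using ln_divide_pos[of "real (Suc (Suc s))" "real (Suc s)"] by (simp add: field_simps)
      also have "\<dots> \<le> 1 / real (Suc s)" by (intro ln_add_one_self_le_self) simp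
      finally show "ln (real (Suc (Suc s))) - ln (real (Suc s)) \<le> 1 / real (Suc s)" .
    qed (use x in auto)
    then have "real (Suc n) * binomial_mean n x (\<lambda>s. ln (real (Suc (Suc s))) - ln (real (Suc s)))
        \<le> real (Suc n) * binomial_mean n x (\<lambda>s. 1 / real (Suc s))"
      by (intro mult_left_mono) auto
    also have "\<dots> \<le> 1 / x"
      using binomial_mean_inverse_Suc[of x n] x by (simp add: field_simps)
    finally show ?thesis unfolding Suc by simp
  qed (use x in simp)
  then show "real k * (real (k - 1) * binomial_mean (k - 1 - 1) x (\<lambda>s. ln (real (Suc (Suc s))) - ln (real (Suc s)))
        - 1 / x) \<le> 0"
    by (intro mult_nonneg_nonpos) auto
qed simp

section \<open>Entropy of Bin(k, x) as a function of x\<close>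

lemma ln_Bernstein:
  assumes "0 < x" "x < 1" "s \<le> k"
  shows "ln (Bernstein k s x) = ln (fact k) - ln (fact s) - ln (fact (k - s))
    + real s * ln x + real (k - s) * ln (1 - x)"
proof -
  have "Bernstein k s x = fact k / (fact s * fact (k - s)) * x ^ s * (1 - x) ^ (k - s)"
    using assms by (simp add: Bernstein_def binomial_fact)
  then show ?thesis using assms by (simp add: ln_mult ln_div ln_realpow)
qed

text \<open>Writing C(k, s) in factorials separates the surprise into a function of s and one of k -
  s; reflection makes the second a copy of the first at 1 - x.\<close>

lemma coeff_entropy_binomial:
  fixes k :: nat
  assumes "0 < x" "x < 1"
  defines "A \<equiv> \<lambda>x. binomial_mean k x (\<lambda>s. ln (fact s)) - real k * (x * ln x)"
  shows "coeff_entropy k (adder_gf (\<lambda>_. x) {..<k}) = A x + A (1 - x) - ln (fact k)"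
proof -
  have "coeff_entropy k (adder_gf (\<lambda>_. x) {..<k}) = - binomial_mean k x (\<lambda>s. ln (Bernstein k s x))"
    by (simp add: coeff_entropy_def binomial_mean_def coeff_adder_gf_const)
  also have "binomial_mean k x (\<lambda>s. ln (Bernstein k s x))
      = binomial_mean k x (\<lambda>s. ln (fact k) - ln (fact s) - ln (fact (k - s))
          + ln x * real s + ln (1 - x) * real (k - s))"
    unfolding binomial_mean_def using assms by (intro sum.cong) (simp_all add: ln_Bernstein mult_ac)
  also have "\<dots> = ln (fact k) - binomial_mean k x (\<lambda>s. ln (fact s))
      - binomial_mean k (1 - x) (\<lambda>s. ln (fact s)) + ln x * (real k * x) + ln (1 - x) * (real k * (1 - x))"
    using binomial_mean_reflect[of k x "\<lambda>s. ln (fact s)"] binomial_mean_reflect[of k x real]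
    by (simp add: binomial_mean_add binomial_mean_diff binomial_mean_cmult binomial_mean_const binomial_mean_real)
  finally show ?thesis unfolding A_def by (simp add: algebra_simps)
qed

lemma coeff_entropy_binomial_le_half:
  assumes "0 < x" "x < 1"
  shows "coeff_entropy k (adder_gf (\<lambda>_. x) {..<k}) \<le> coeff_entropy k (adder_gf (\<lambda>_. 1/2) {..<k})"
proof -
  define A where "A = (\<lambda>x. binomial_mean k x (\<lambda>s. ln (fact s)) - real k * (x * ln x))"
  \<comment> \<open>The midpoint of x and 1 - x is 1/2, so midpoint concavity of A settles the
    comparison.\<close>
  have "(1/2) * A x + (1/2) * A (1 - x) \<le> A ((1/2) *\<^sub>R x + (1/2) *\<^sub>R (1 - x))"
    using concave_onD[OF concave_on_binomial_entropy_half[of k], of "1/2" x "1 - x"] assms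
    unfolding A_def by simp
  also have "(1/2) *\<^sub>R x + (1/2) *\<^sub>R (1 - x) = 1/2" by (simp add: field_simps)
  finally have "A x + A (1 - x) \<le> 2 * A (1/2)" by simp
  then show ?thesis
    using coeff_entropy_binomial[OF assms, of k] coeff_entropy_binomial[of "1/2" k]
    unfolding A_def by simp
qed

lemma coeff_entropy_le_half_open:
  assumes "\<And>i. i < k \<Longrightarrow> 0 < p i \<and> p i < 1"
  shows "coeff_entropy k (adder_gf p {..<k}) \<le> coeff_entropy k (adder_gf (\<lambda>_. 1/2) {..<k})"
proof (cases "k = 0")
  case False
  define m where "m = (\<Sum>i<k. p i) / real k"
  have sum: "(\<Sum>i<k. p i) = real k * m" using False by (simp add: m_def)
  have "(\<Sum>i<k. p i) < (\<Sum>i<k. 1)"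
    using assms False by (intro sum_strict_mono) auto
  moreover have "0 < (\<Sum>i<k. p i)"
    using assms False by (intro sum_pos) auto
  ultimately have "0 < m" "m < 1" using False by (simp_all add: m_def field_simps)
  then show ?thesis
    using coeff_entropy_le_mean[OF assms sum] coeff_entropy_binomial_le_half[of m k] by simp
qed (simp add: adder_gf_def)

section \<open>Extension to success probabilities 0 and 1\<close>

lemma isCont_coeff_adder_gf:
  assumes "finite A" "\<And>i. i \<in> A \<Longrightarrow> isCont (\<lambda>t. p t i) t0"
  shows "isCont (\<lambda>t. coeff (adder_gf (p t) A) s) t0"
  using assms
proof (induction A arbitrary: s rule: finite_induct)
  case (insert i A)
  then show ?case
    by (cases s) (auto simp: adder_gf_def intro!: continuous_intros)
qed (simp add: adder_gf_def)

text \<open>Since x ln x tends to 0 from the right and \<open>ln 0 = 0\<close>, the product is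
  continuous on the closed half-line although ln is not. Coefficients may therefore vanish in the
  limit.\<close>

lemma tendsto_times_ln:
  fixes f :: "'a \<Rightarrow> real"
  assumes "(f \<longlongrightarrow> a) F" "eventually (\<lambda>t. 0 \<le> f t) F"
  shows "((\<lambda>t. f t * ln (f t)) \<longlongrightarrow> a * ln a) F"
proof (cases "a = 0")
  case False
  then show ?thesis using assms by (intro tendsto_intros)
next
  case True
  have lim: "((\<lambda>x::real. x * ln x) \<longlongrightarrow> 0) (at 0 within {0..})"
  proof -
    have "((\<lambda>x::real. x * ln x) \<longlongrightarrow> 0) (at_right 0)" by real_asymp
    then show ?thesis by (simp add: at_within_Ici_at_right)
  qed
  have "continuous_on {0::real..} (\<lambda>x. x * ln x)"
    unfolding continuous_on_def
  proof
    fix x :: real assume "x \<in> {0..}"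
    then show "((\<lambda>x. x * ln x) \<longlongrightarrow> x * ln x) (at x within {0..})"
      using lim by (cases "x = 0") (auto intro!: tendsto_intros)
  qed
  then show ?thesis
    using assms True by (intro continuous_on_tendsto_compose[of "{0..}" "\<lambda>x. x * ln x"]) auto
qed

lemma coeff_entropy_le_half:
  assumes "\<And>i. i < k \<Longrightarrow> 0 \<le> p i \<and> p i \<le> 1"
  shows "coeff_entropy k (adder_gf p {..<k}) \<le> coeff_entropy k (adder_gf (\<lambda>_. 1/2) {..<k})"
proof -
  \<comment> \<open>The segment from p to the constant 1/2; for 0 < t < 1 all its parameters are
    interior.\<close>
  define q where "q t i = p i + t * (1/2 - p i)" for t i
  have q: "0 < q t i \<and> q t i < 1" if "0 < t" "t < 1" "i < k" for t i
  proof -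
    have "0 < (1 - t) * p i + t / 2" "0 < (1 - t) * (1 - p i) + t / 2"
      using that assms[of i] by (auto intro!: add_nonneg_pos)
    then show ?thesis by (simp add: q_def algebra_simps)
  qed
  have small: "eventually (\<lambda>t::real. 0 < t \<and> t < 1) (at_right 0)"
    by (intro eventually_conj) real_asymp+
  have lim: "((\<lambda>t. coeff_entropy k (adder_gf (q t) {..<k})) \<longlongrightarrow> coeff_entropy k (adder_gf p {..<k})) (at_right 0)"
    unfolding coeff_entropy_def
  proof (intro tendsto_minus tendsto_sum tendsto_times_ln)
    fix s
    have "isCont (\<lambda>t. coeff (adder_gf (q t) {..<k}) s) 0"
      by (intro isCont_coeff_adder_gf) (auto simp: q_def intro!: continuous_intros)
    then have "((\<lambda>t. coeff (adder_gf (q t) {..<k}) s) \<longlongrightarrow> coeff (adder_gf (q 0) {..<k}) s) (at 0)"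
      by (simp add: isCont_def)
    moreover have "q 0 = p" by (simp add: q_def fun_eq_iff)
    ultimately show "((\<lambda>t. coeff (adder_gf (q t) {..<k}) s) \<longlongrightarrow> coeff (adder_gf p {..<k}) s) (at_right 0)"
      by (auto intro: tendsto_mono[OF at_le])
    show "eventually (\<lambda>t. 0 \<le> coeff (adder_gf (q t) {..<k}) s) (at_right 0)"
      using small by eventually_elim (intro coeff_adder_gf_nonneg, use q in \<open>auto simp: less_imp_le\<close>)
  qed
  have "eventually (\<lambda>t. coeff_entropy k (adder_gf (q t) {..<k}) \<le> coeff_entropy k (adder_gf (\<lambda>_. 1/2) {..<k})) (at_right 0)"
    using small by eventually_elim (intro coeff_entropy_le_half_open, use q in auto)
  then show ?thesis
    by (intro tendsto_upperbound[OF lim]) (auto simp: trivial_limit_at_right_real)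
qed

section \<open>Stirling's formula with the first correction term\<close>

text \<open>Increments dominated by those of a null sequence telescope to |f n - f m| \<le> e m - e
  n for m \<le> n. This makes f a Cauchy sequence, and letting n grow gives the rate.\<close>

lemma eventually_close_to_limit:
  fixes f e :: "nat \<Rightarrow> real"
  assumes step: "eventually (\<lambda>m. \<bar>f (Suc m) - f m\<bar> \<le> e m - e (Suc m)) sequentially"
    and e: "e \<longlonglongrightarrow> 0"
  obtains c where "f \<longlonglongrightarrow> c" "eventually (\<lambda>m. \<bar>f m - c\<bar> \<le> e m) sequentially"
proof -
  obtain N where N: "\<And>m. m \<ge> N \<Longrightarrow> \<bar>f (Suc m) - f m\<bar> \<le> e m - e (Suc m)"
    using step by (auto simp: eventually_sequentially)
  have tel: "\<bar>f n - f m\<bar> \<le> e m - e n" if "N \<le> m" "m \<le> n" for m n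
    using that(2)
  proof (induction n rule: dec_induct)
    case (step n)
    then show ?case using N[of n] that(1) by linarith
  qed simp
  have tel_lim: "eventually (\<lambda>n. \<bar>f n - f m\<bar> \<le> e m - e n) sequentially" if "N \<le> m" for m
    using eventually_ge_at_top[of m] by eventually_elim (use tel that in auto)
  have "Cauchy f"
  proof (rule metric_CauchyI)
    fix r :: real assume "0 < r"
    then have "eventually (\<lambda>m. \<bar>e m\<bar> < r / 2) sequentially"
      using tendstoD[OF e, of "r / 2"] by (simp add: dist_real_def)
    then obtain M where M: "\<And>m. m \<ge> M \<Longrightarrow> \<bar>e m\<bar> < r / 2" by (auto simp: eventually_sequentially)
    show "\<exists>M. \<forall>m\<ge>M. \<forall>n\<ge>M. dist (f m) (f n) < r"
    proof (intro exI allI impI)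
      fix m n assume "max M N \<le> m" "max M N \<le> n"
      then have "\<bar>f n - f m\<bar> \<le> \<bar>e m\<bar> + \<bar>e n\<bar>"
        using tel[of m n] tel[of n m] by (cases "m \<le> n") auto
      also have "\<dots> < r" using M[of m] M[of n] \<open>max M N \<le> m\<close> \<open>max M N \<le> n\<close> by simp
      finally show "dist (f m) (f n) < r" by (simp add: dist_real_def abs_minus_commute)
    qed
  qed
  then obtain c where c: "f \<longlonglongrightarrow> c" by (auto simp: Cauchy_convergent_iff convergent_def)
  have "\<bar>f m - c\<bar> \<le> e m" if "N \<le> m" for m
  proof -
    have "\<bar>c - f m\<bar> \<le> e m - 0"
      using tel_lim[OF that]
      by (rule tendsto_le[OF sequentially_bot _ _ , rotated 2]) (intro tendsto_intros c e)+
    then show ?thesis by (simp add: abs_minus_commute)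
  qed
  then have "eventually (\<lambda>m. \<bar>f m - c\<bar> \<le> e m) sequentially"
    by (auto simp: eventually_sequentially)
  with c show ?thesis by (rule that)
qed

text \<open>Expresses the partial Wallis products through n! and (2n)!, so that their limit can fix
  the constant in Stirling's formula.\<close>

lemma wallis_product_fact:
  "(\<Prod>k=1..n. (4 * real k ^ 2) / (4 * real k ^ 2 - 1))
    = 16 ^ n * fact n ^ 4 / (fact (2 * n) ^ 2 * (2 * real n + 1))"
proof (induction n)
  case (Suc n)
  have alg: "P * x ^ 4 / (y\<^sup>2 * b) * (4 * a\<^sup>2 / (b * c)) = 16 * P * (a * x) ^ 4 / ((2 * a * b * y)\<^sup>2 * c)"
    if "a > 0" "b > 0" "c > 0" "y > 0" for a b c x y P :: real
    using that by (simp add: divide_simps) (simp add: power2_eq_square power4_eq_xxxx)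
  have "4 * (real n + 1)\<^sup>2 - 1 = (2 * real n + 1) * (2 * real n + 3)"
    by (simp add: power2_eq_square algebra_simps)
  moreover have "(fact (2 * Suc n) :: real) = 2 * (real n + 1) * (2 * real n + 1) * fact (2 * n)"
    by (simp add: algebra_simps)
  moreover have "2 * (real n + 1) + 1 = 2 * real n + 3" "(fact (Suc n) :: real) = (real n + 1) * fact n"
    "real (Suc n) = real n + 1"
    by (simp_all add: algebra_simps)
  moreover have "(\<Prod>k=1..Suc n. (4 * real k ^ 2) / (4 * real k ^ 2 - 1))
      = (\<Prod>k=1..n. (4 * real k ^ 2) / (4 * real k ^ 2 - 1)) * (4 * real (Suc n) ^ 2 / (4 * real (Suc n) ^ 2 - 1))"
    by (rule prod.cl_ivl_Suc[of _ 1 n, THEN trans]) simp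
  ultimately show ?case
    using alg[of "real n + 1" "2 * real n + 1" "2 * real n + 3" "fact (2 * n)" "16 ^ n" "fact n"]
    by (simp only: Suc.IH power_Suc) (simp add: add_pos_nonneg)
qed simp

text \<open>The additive constant ln (2 pi) / 2 is kept out, because it is identified only after
  convergence is known.\<close>

definition stirling :: "real \<Rightarrow> real" where
  "stirling x = (x + 1/2) * ln x - x + 1 / (12 * x)"

lemma ln_fact_stirling:
  "eventually (\<lambda>m. \<bar>ln (fact m) - (stirling (real m) + ln (2 * pi) / 2)\<bar> \<le> 1 / real m ^ 3) sequentially"
proof -
  define d where "d m = ln (fact m) - stirling (real m)" for m
  define g where "g x = (x + 1/2) * ln (1 + 1 / x) - 1 - 1 / (12 * x) + 1 / (12 * (x + 1))" for x :: real
  have dg: "d (Suc m) - d m = - g (real m)" if "m > 0" for m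
  proof -
    have "ln (fact (Suc m) :: real) = ln (real (Suc m)) + ln (fact m)"
      unfolding fact_Suc by (subst ln_mult) auto
    moreover have lnq: "ln (1 + 1 / real m) = ln (real m + 1) - ln (real m)"
      using that ln_divide_pos[of "real m + 1" "real m"] by (simp add: field_simps)
    ultimately show ?thesis unfolding d_def g_def stirling_def lnq by (simp add: algebra_simps)
  qed
  \<comment> \<open>The increment -g m is asymptotic to 1 / (120 m^4), well below the right side,
    which behaves like 3 / m^4.\<close>
  have "eventually (\<lambda>m. g (real m) \<le> 1 / real m ^ 3 - 1 / (real m + 1) ^ 3) sequentially"
    unfolding g_def by real_asymp
  moreover have "eventually (\<lambda>m. - g (real m) \<le> 1 / real m ^ 3 - 1 / (real m + 1) ^ 3) sequentially"
    unfolding g_def by real_asymp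
  ultimately have step: "eventually (\<lambda>m. \<bar>d (Suc m) - d m\<bar> \<le> 1 / real m ^ 3 - 1 / real (Suc m) ^ 3) sequentially"
    using eventually_gt_at_top[of 0]
    by eventually_elim (simp add: dg add.commute abs_le_iff)
  have "(\<lambda>m. 1 / real m ^ 3) \<longlonglongrightarrow> 0" by real_asymp
  from eventually_close_to_limit[OF step this] obtain c
    where c: "d \<longlonglongrightarrow> c" "eventually (\<lambda>m. \<bar>d m - c\<bar> \<le> 1 / real m ^ 3) sequentially" .
  \<comment> \<open>The explicit part of the logarithm of the Wallis product, left over when ln n!
    and ln (2n)! are written as d plus \<open>stirling\<close>. Its limit -2 ln 2 yields 2 c - 2 ln
    2 = ln (pi / 2).\<close>
  define b where "b n = real n * ln 16 + 4 * stirling (real n) - 2 * stirling (2 * real n) - ln (2 * real n + 1)" for n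
  have b: "b \<longlonglongrightarrow> - 2 * ln 2"
  proof (rule Lim_transform_eventually)
    show "(\<lambda>n. ln (real n) - ln (2 * real n + 1) - ln 2 + 1 / (4 * real n)) \<longlonglongrightarrow> - 2 * ln 2"
      by real_asymp
    have ln16: "ln (16::real) = 4 * ln 2" using ln_realpow[of 2 4] by simp
    show "eventually (\<lambda>n. ln (real n) - ln (2 * real n + 1) - ln 2 + 1 / (4 * real n) = b n) sequentially"
      using eventually_gt_at_top[of 0]
      by eventually_elim (simp add: b_def stirling_def ln16 ln_mult field_simps)
  qed
  have "strict_mono (\<lambda>n::nat. 2 * n)" by (auto simp: strict_mono_def)
  from LIMSEQ_subseq_LIMSEQ[OF c(1) this] have "(\<lambda>n. 4 * d n - 2 * d (2 * n) + b n) \<longlonglongrightarrow> 4 * c - 2 * c + - 2 * ln 2"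
    by (intro tendsto_intros c(1) b) (simp add: o_def)
  moreover have "(\<lambda>n. ln (\<Prod>k=1..n. (4 * real k ^ 2) / (4 * real k ^ 2 - 1))) \<longlonglongrightarrow> ln (pi / 2)"
    by (intro tendsto_ln wallis) simp
  moreover have "ln (\<Prod>k=1..n. (4 * real k ^ 2) / (4 * real k ^ 2 - 1)) = 4 * d n - 2 * d (2 * n) + b n" for n
  proof -
    have "ln (16 ^ n * fact n ^ 4 / (fact (2 * n) ^ 2 * (2 * real n + 1)))
        = real n * ln 16 + 4 * ln (fact n) - 2 * ln (fact (2 * n)) - ln (2 * real n + 1)"
      by (simp add: ln_mult ln_div ln_realpow add_pos_nonneg)
    then show ?thesis unfolding wallis_product_fact by (simp add: d_def b_def)
  qed
  ultimately have "4 * c - 2 * c + - 2 * ln 2 = ln (pi / 2)"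
    by (intro LIMSEQ_unique) simp_all
  then have "c = ln (2 * pi) / 2" by (simp add: ln_mult ln_div)
  with c(2) show ?thesis by (simp add: d_def algebra_simps)
qed

section \<open>Expansion of the surprise of the symmetric binomial law\<close>

text \<open>The Taylor remainders are evaluated at u = (2s - n)/n for all n and s at once, which
  calls for a fixed radius and constant, and for the point u = 0 that the filter \<open>at 0\<close>
  omits.\<close>

lemma bigo_at_0_bound:
  fixes f :: "real \<Rightarrow> real"
  assumes "f \<in> O[at 0](\<lambda>u. u ^ m)" "f 0 = 0"
  obtains r C where "r > 0" "C \<ge> 0" "\<And>u. \<bar>u\<bar> < r \<Longrightarrow> \<bar>f u\<bar> \<le> C * \<bar>u\<bar> ^ m"
proof -
  obtain C where C: "C > 0" "eventually (\<lambda>u. norm (f u) \<le> C * norm (u ^ m)) (at 0)"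
    using assms(1) by (rule landau_o.bigE)
  then obtain r where r: "r > 0" "\<And>u. u \<noteq> 0 \<Longrightarrow> dist u 0 < r \<Longrightarrow> norm (f u) \<le> C * norm (u ^ m)"
    by (auto simp: eventually_at)
  show ?thesis
  proof
    show "\<bar>f u\<bar> \<le> C * \<bar>u\<bar> ^ m" if "\<bar>u\<bar> < r" for u
      using r(2)[of u] that C(1) assms(2) by (cases "u = 0") (auto simp: power_abs abs_mult)
  qed (use r C in auto)
qed

text \<open>The square of the standardised sum: Bin(n, 1/2) has mean n/2 and variance n/4.\<close>

definition sq_dev :: "nat \<Rightarrow> nat \<Rightarrow> real" where
  "sq_dev n s = (2 * real s - real n)\<^sup>2 / real n"

definition binomial_surprise :: "nat \<Rightarrow> nat \<Rightarrow> real" where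
  "binomial_surprise n s = - ln (Bernstein n s (1/2))"

text \<open>Up to the order 1/n^2, the Taylor expansion in u = (2s - n)/n of
  n/2 ((1+u) ln (1+u) + (1-u) ln (1-u)) + ln (1-u^2)/2 - 1/(12n) + 1/(3n (1-u^2)), with u^2 = v/n.\<close>

definition surprise_expansion :: "nat \<Rightarrow> real \<Rightarrow> real" where
  "surprise_expansion n v = v / 2 + (v ^ 2 / 12 - v / 2 + 1/4) / real n
     + (v ^ 3 / 30 - v ^ 2 / 4 + v / 3) / real n ^ 2"

lemma Bernstein_half:
  assumes "s \<le> n"
  shows "Bernstein n s (1/2) = real (n choose s) / 2 ^ n"
proof -
  have "(1/2::real) ^ s * (1/2) ^ (n - s) = (1/2) ^ n"
    unfolding power_add[symmetric] using assms by simp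
  moreover have "1 - 1/2 = (1/2::real)" by simp
  ultimately have "Bernstein n s (1/2) = real (n choose s) * (1/2) ^ n"
    unfolding Bernstein_def mult.assoc by metis
  then show ?thesis by (simp only: power_one_over) (simp add: field_simps)
qed

lemma binomial_surprise_fact:
  assumes "s \<le> n"
  shows "binomial_surprise n s = real n * ln 2 - ln (fact n) + ln (fact s) + ln (fact (n - s))"
  using assms
  by (simp add: binomial_surprise_def Bernstein_half binomial_fact ln_div ln_mult ln_realpow)

text \<open>From 1 \<le> C(n, s) \<le> 2^n and ln 2 < 1. A bound of order n suffices away from the
  centre, where v^4 / n^3 is itself of order n.\<close>

lemma binomial_surprise_bounds:
  assumes "s \<le> n"
  shows "0 \<le> binomial_surprise n s" "binomial_surprise n s \<le> real n"
proof -
  have c: "0 < real (n choose s)" "1 \<le> real (n choose s)"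
    using zero_less_binomial[OF assms] by linarith+
  have le: "real (n choose s) \<le> 2 ^ n"
    using binomial_le_pow2[of n s] by (metis of_nat_le_iff of_nat_numeral of_nat_power)
  have eq: "binomial_surprise n s = real n * ln 2 - ln (real (n choose s))"
    using assms c by (simp add: binomial_surprise_def Bernstein_half ln_div ln_realpow)
  have "ln (real (n choose s)) \<le> ln (2 ^ n)" using c le by (subst ln_le_cancel_iff) auto
  then show "0 \<le> binomial_surprise n s" by (simp add: eq ln_realpow)
  have "real n * ln 2 \<le> real n * 1" using ln_2_less_1 by (intro mult_left_mono) auto
  moreover have "0 \<le> ln (real (n choose s))" using c by simp
  ultimately show "binomial_surprise n s \<le> real n" unfolding eq by linarith
qed

text \<open>An exact identity: Taylor polynomials in u are subtracted so that the last three
  summands are pure remainders. They are truncated at different degrees because n u^8, u^6 and u^4 /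
  n are v^4, v^3 and v^2 over n^3.\<close>

lemma stirling_binomial:
  assumes n: "n > 0" and u: "\<bar>u\<bar> < 1"
  defines "a \<equiv> n * (1 + u) / 2" and "b \<equiv> n * (1 - u) / 2" and "v \<equiv> n * u\<^sup>2"
  shows "n * ln 2 - (stirling n + ln (2 * pi) / 2) + (stirling a + ln (2 * pi) / 2) + (stirling b + ln (2 * pi) / 2)
    = ln (pi * n / 2) / 2 + (v / 2 + (v ^ 2 / 12 - v / 2 + 1/4) / n + (v ^ 3 / 30 - v ^ 2 / 4 + v / 3) / n ^ 2)
      + n / 2 * ((1 + u) * ln (1 + u) + (1 - u) * ln (1 - u) - u^2 - u^4 / 6 - u^6 / 15)
      + (ln (1 + u) + ln (1 - u) + u^2 + u^4 / 2) / 2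
      + (1 / (1 + u) + 1 / (1 - u) - 2 - 2 * u^2) / (6 * n)"
proof -
  have u': "1 + u > 0" "1 - u > 0" using u by auto
  have lna: "ln a = ln n - ln 2 + ln (1 + u)" and lnb: "ln b = ln n - ln 2 + ln (1 - u)"
    using n u' by (simp_all add: a_def b_def ln_div ln_mult)
  have lnp: "ln (pi * n / 2) = ln pi + ln n - ln 2" "ln (2 * pi) = ln 2 + ln pi"
    using n by (simp_all add: ln_div ln_mult)
  have "12 * a = (1 + u) * (6 * n)" "12 * b = (1 - u) * (6 * n)"
    by (simp_all add: a_def b_def)
  then have "1 / (12 * a) = 1 / (1 + u) / (6 * n)" "1 / (12 * b) = 1 / (1 - u) / (6 * n)"
    by (simp_all only: divide_divide_eq_left)
  then have sa: "stirling a = (a + 1/2) * (ln n - ln 2 + ln (1 + u)) - a + 1 / (1 + u) / (6 * n)"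
    and sb: "stirling b = (b + 1/2) * (ln n - ln 2 + ln (1 - u)) - b + 1 / (1 - u) / (6 * n)"
    by (simp_all add: stirling_def lna lnb)
  have q: "v / 2 + (v ^ 2 / 12 - v / 2 + 1/4) / n + (v ^ 3 / 30 - v ^ 2 / 4 + v / 3) / n ^ 2
      = n / 2 * (u^2 + u^4 / 6 + u^6 / 15) - (u^2 + u^4 / 2) / 2 + (2 + 2 * u^2) / (6 * n) - 1 / (12 * n)"
  proof -
    have "v ^ 2 = n ^ 2 * u ^ 4" "v ^ 3 = n ^ 3 * u ^ 6"
      by (simp_all add: v_def power_mult_distrib flip: power_mult)
    then have e: "v ^ 2 / n = n * u ^ 4" "v ^ 2 / n ^ 2 = u ^ 4" "v ^ 3 / n ^ 2 = n * u ^ 6"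
      "v / n = u ^ 2" "v / n ^ 2 = u ^ 2 / n"
      using n by (simp_all add: v_def power2_eq_square power3_eq_cube)
    have e1: "v / 2 + (v ^ 2 / 12 - v / 2 + 1/4) / n + (v ^ 3 / 30 - v ^ 2 / 4 + v / 3) / n ^ 2
        = v / 2 + (v ^ 2 / n) / 12 - (v / n) / 2 + 1 / 4 / n
          + (v ^ 3 / n ^ 2) / 30 - (v ^ 2 / n ^ 2) / 4 + (v / n ^ 2) / 3"
      by (simp add: add_divide_distrib diff_divide_distrib)
    have e2: "(2 + 2 * u^2) / (6 * n) - 1 / (12 * n) = 1 / 4 / n + u ^ 2 / n / 3"
      using n by (simp add: field_simps)
    have "v / 2 + n * u^4 / 12 - u^2 / 2 + 1 / 4 / n + n * u^6 / 30 - u^4 / 4 + u^2 / n / 3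
        = n / 2 * (u^2 + u^4 / 6 + u^6 / 15) - (u^2 + u^4 / 2) / 2 + (1 / 4 / n + u^2 / n / 3)"
      by (simp add: v_def algebra_simps add_divide_distrib)
    then show ?thesis unfolding e1 e add_diff_eq[symmetric] e2 .
  qed
  have t3: "(1 / (1 + u) + 1 / (1 - u) - 2 - 2 * u^2) / (6 * n)
      = 1 / (1 + u) / (6 * n) + 1 / (1 - u) / (6 * n) - (2 + 2 * u^2) / (6 * n)"
    by (simp add: diff_divide_distrib add_divide_distrib)
  \<comment> \<open>With logarithms, reciprocals and powers of u as independent variables, only
    rational algebra remains.\<close>
  have alg: "n * L2 - ((n + 1/2) * Ln - n + i0 + (L2 + Lp) / 2)
      + ((n * (1 + u) / 2 + 1/2) * (Ln - L2 + la) - n * (1 + u) / 2 + ia + (L2 + Lp) / 2)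
      + ((n * (1 - u) / 2 + 1/2) * (Ln - L2 + lb) - n * (1 - u) / 2 + ib + (L2 + Lp) / 2)
      = (Lp + Ln - L2) / 2 + (n / 2 * (u2 + u4 / 6 + u6 / 15) - (u2 + u4 / 2) / 2 + w - i0)
        + n / 2 * ((1 + u) * la + (1 - u) * lb - u2 - u4 / 6 - u6 / 15) + (la + lb + u2 + u4 / 2) / 2 + (ia + ib - w)"
    for L2 Ln Lp la lb ia ib i0 w u2 u4 u6 :: real
    by (simp add: field_simps)
  show ?thesis
    unfolding sa sb q t3 lnp stirling_def[of n] unfolding a_def b_def by (rule alg)
qed

lemma surprise_expansion_central:
  obtains r C where "r > 0" "r \<le> 1/2" "C \<ge> 0"
    "eventually (\<lambda>n. \<forall>s\<le>n. \<bar>2 * real s - real n\<bar> < r * real n \<longrightarrow>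
       \<bar>binomial_surprise n s - ln (pi * real n / 2) / 2 - surprise_expansion n (sq_dev n s)\<bar>
         \<le> C * (1 + sq_dev n s ^ 4) / real n ^ 3) sequentially"
proof -
  define t1 where "t1 u = (1 + u) * ln (1 + u) + (1 - u) * ln (1 - u) - u^2 - u^4 / 6 - u^6 / 15" for u :: real
  define t2 where "t2 u = ln (1 + u) + ln (1 - u) + u^2 + u^4 / 2" for u :: real
  define t3 where "t3 u = 1 / (1 + u) + 1 / (1 - u) - 2 - 2 * u^2" for u :: real
  have "t1 \<in> O[at 0](\<lambda>u. u ^ 8)" unfolding t1_def by real_asymp
  then obtain r1 C1 where t1: "r1 > 0" "C1 \<ge> 0" "\<And>u. \<bar>u\<bar> < r1 \<Longrightarrow> \<bar>t1 u\<bar> \<le> C1 * \<bar>u\<bar> ^ 8"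
    by (rule bigo_at_0_bound) (simp_all add: t1_def)
  have "t2 \<in> O[at 0](\<lambda>u. u ^ 6)" unfolding t2_def by real_asymp
  then obtain r2 C2 where t2: "r2 > 0" "C2 \<ge> 0" "\<And>u. \<bar>u\<bar> < r2 \<Longrightarrow> \<bar>t2 u\<bar> \<le> C2 * \<bar>u\<bar> ^ 6"
    by (rule bigo_at_0_bound) (simp_all add: t2_def)
  have "t3 \<in> O[at 0](\<lambda>u. u ^ 4)" unfolding t3_def by real_asymp
  then obtain r3 C3 where t3: "r3 > 0" "C3 \<ge> 0" "\<And>u. \<bar>u\<bar> < r3 \<Longrightarrow> \<bar>t3 u\<bar> \<le> C3 * \<bar>u\<bar> ^ 4"
    by (rule bigo_at_0_bound) (simp_all add: t3_def)
  \<comment> \<open>The cap 1/2 gives (1 + u)/2 and (1 - u)/2 at least 1/4, so s and n - s are at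
    least n/4 and Stirling's formula applies to both.\<close>
  define r where "r = Min {r1, r2, r3, 1/2}"
  have r: "r > 0" "r \<le> r1" "r \<le> r2" "r \<le> r3" "r \<le> 1/2"
    using t1(1) t2(1) t3(1) by (auto simp: r_def)
  obtain M where M: "\<And>m. m \<ge> M \<Longrightarrow> \<bar>ln (fact m) - (stirling (real m) + ln (2 * pi) / 2)\<bar> \<le> 1 / real m ^ 3"
    using ln_fact_stirling by (auto simp: eventually_sequentially)
  \<comment> \<open>129 = 1 + 64 + 64 collects the Stirling errors at n, s and n - s; 64 is the cube
    of 4.\<close>
  define C where "C = C1 + C2 + C3 + 129"
  have bound: "\<bar>binomial_surprise n s - ln (pi * real n / 2) / 2 - surprise_expansion n (sq_dev n s)\<bar>
         \<le> C * (1 + sq_dev n s ^ 4) / real n ^ 3"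
    if n: "n \<ge> 4 * M + 1" and s: "s \<le> n" and c: "\<bar>2 * real s - real n\<bar> < r * real n" for n s
  proof -
    define u where "u = (2 * real s - real n) / real n"
    define v where "v = sq_dev n s"
    have n0: "real n > 0" using n by simp
    have u: "\<bar>u\<bar> < r" using c n0 by (simp add: u_def field_simps)
    have v: "v = real n * u\<^sup>2" "0 \<le> v"
      using n0 by (simp_all add: v_def sq_dev_def u_def power_divide power2_eq_square)
    have a: "real s = real n * (1 + u) / 2" and b: "real (n - s) = real n * (1 - u) / 2"
      using n0 s by (simp_all add: u_def field_simps of_nat_diff)
    have large: "real n / 4 \<le> real s" "real n / 4 \<le> real (n - s)"
      unfolding a b using mult_left_mono[of "1/2" "1 + u" "real n"] mult_left_mono[of "1/2" "1 - u" "real n"]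
        u r(5) n0 by auto
    then have M': "M \<le> s" "M \<le> n - s" "M \<le> n" using n by linarith+
    have small: "1 / real m ^ 3 \<le> 64 / real n ^ 3" if "real n / 4 \<le> real m" for m
    proof -
      have "(real n / 4) ^ 3 \<le> real m ^ 3" using that by (intro power_mono) auto
      then have "1 / real m ^ 3 \<le> 1 / (real n / 4) ^ 3"
        using n0 by (intro divide_left_mono) (auto intro!: mult_pos_pos)
      then show ?thesis by (simp add: power_divide)
    qed
    define E where "E m = ln (fact m) - (stirling (real m) + ln (2 * pi) / 2)" for m
    have E: "\<bar>E n\<bar> \<le> 1 / real n ^ 3" "\<bar>E s\<bar> \<le> 64 / real n ^ 3" "\<bar>E (n - s)\<bar> \<le> 64 / real n ^ 3"
      using M[OF M'(3)] M[OF M'(1)] M[OF M'(2)] small[OF large(1)] small[OF large(2)]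
      by (simp_all add: E_def)
    have u1: "\<bar>u\<bar> < 1" using u r by simp
    have "binomial_surprise n s = real n * ln 2 - (stirling (real n) + ln (2 * pi) / 2)
        + (stirling (real s) + ln (2 * pi) / 2) + (stirling (real (n - s)) + ln (2 * pi) / 2) + (E s + E (n - s) - E n)"
      using binomial_surprise_fact[OF s] by (simp add: E_def)
    also have "\<dots> = ln (pi * real n / 2) / 2 + surprise_expansion n v
        + real n / 2 * t1 u + t2 u / 2 + t3 u / (6 * real n) + (E s + E (n - s) - E n)"
      unfolding a b stirling_binomial[OF n0 u1] surprise_expansion_def v(1) t1_def t2_def t3_def by simp
    finally have "\<bar>binomial_surprise n s - ln (pi * real n / 2) / 2 - surprise_expansion n v\<bar>
        = \<bar>real n / 2 * t1 u + t2 u / 2 + t3 u / (6 * real n) + (E s + E (n - s) - E n)\<bar>" by simp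
    also have "\<dots> \<le> \<bar>real n / 2 * t1 u\<bar> + \<bar>t2 u / 2\<bar> + \<bar>t3 u / (6 * real n)\<bar> + 129 / real n ^ 3"
      using E by linarith
    also have "\<bar>real n / 2 * t1 u\<bar> \<le> C1 * v ^ 4 / real n ^ 3"
    proof -
      have "\<bar>real n / 2 * t1 u\<bar> = real n / 2 * \<bar>t1 u\<bar>" using n0 by (simp add: abs_mult)
      also have "\<dots> \<le> real n * (C1 * \<bar>u\<bar> ^ 8)"
        using t1(3)[of u] u r n0 t1(2) by (intro mult_mono) auto
      also have "\<dots> = C1 * v ^ 4 / real n ^ 3"
        using n0 by (simp add: v field_simps eval_nat_numeral)
      finally show ?thesis .
    qed
    also have "\<bar>t2 u / 2\<bar> \<le> C2 * (1 + v ^ 4) / real n ^ 3"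
    proof -
      have "\<bar>t2 u / 2\<bar> \<le> C2 * \<bar>u\<bar> ^ 6"
        using t2(3)[of u] u r by simp
      also have "\<dots> = C2 * v ^ 3 / real n ^ 3"
        using n0 by (simp add: v field_simps eval_nat_numeral)
      also have "v ^ 3 \<le> 1 + v ^ 4"
      proof (cases "v \<le> 1")
        case True
        then show ?thesis using power_le_one[of v 3] v by (simp add: add_increasing2)
      next
        case False
        then show ?thesis using power_increasing[of 3 4 v] by (simp add: add_increasing)
      qed
      finally show ?thesis using t2(2) n0 by (simp add: divide_right_mono mult_left_mono)
    qed
    also have "\<bar>t3 u / (6 * real n)\<bar> \<le> C3 * (1 + v ^ 4) / real n ^ 3"
    proof -
      have "\<bar>t3 u / (6 * real n)\<bar> = \<bar>t3 u\<bar> / (6 * real n)" using n0 by simp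
      also have "\<dots> \<le> (C3 * \<bar>u\<bar> ^ 4) / real n"
        using t3(2) t3(3)[of u] u r n0 by (intro frac_le) auto
      also have "\<dots> = C3 * v ^ 2 / real n ^ 3"
        using n0 by (simp add: v field_simps eval_nat_numeral)
      also have "v ^ 2 \<le> 1 + v ^ 4"
      proof (cases "v \<le> 1")
        case True
        then show ?thesis using power_le_one[of v 2] v by (simp add: add_increasing2)
      next
        case False
        then show ?thesis using power_increasing[of 2 4 v] by (simp add: add_increasing)
      qed
      finally show ?thesis using t3(2) n0 by (simp add: divide_right_mono mult_left_mono)
    qed
    also have "C1 * v ^ 4 / real n ^ 3 + C2 * (1 + v ^ 4) / real n ^ 3 + C3 * (1 + v ^ 4) / real n ^ 3 + 129 / real n ^ 3
        \<le> C * (1 + v ^ 4) / real n ^ 3"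
    proof -
      have "C1 * v ^ 4 + C2 * (1 + v ^ 4) + C3 * (1 + v ^ 4) + 129 \<le> C * (1 + v ^ 4)"
        using t1(2) v by (simp add: C_def algebra_simps)
      then show ?thesis
        using n0 by (simp add: add_divide_distrib[symmetric] divide_right_mono)
    qed
    finally show ?thesis by (simp add: v_def)
  qed
  show ?thesis
  proof
    show "eventually (\<lambda>n. \<forall>s\<le>n. \<bar>2 * real s - real n\<bar> < r * real n \<longrightarrow>
       \<bar>binomial_surprise n s - ln (pi * real n / 2) / 2 - surprise_expansion n (sq_dev n s)\<bar>
         \<le> C * (1 + sq_dev n s ^ 4) / real n ^ 3) sequentially"
      using eventually_ge_at_top[of "4 * M + 1"] by eventually_elim (use bound in auto)
  qed (use r t1 t2 t3 in \<open>auto simp: C_def\<close>)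
qed

text \<open>As |2s - n| \<le> n, also v \<le> n. The 5 consists of 1 for the surprise, 1 for the
  logarithm and 3 for the polynomial.\<close>

lemma surprise_expansion_crude:
  assumes n: "n > 0" and s: "s \<le> n"
  shows "\<bar>binomial_surprise n s - ln (pi * real n / 2) / 2 - surprise_expansion n (sq_dev n s)\<bar> \<le> 5 * real n"
proof -
  define v where "v = sq_dev n s"
  have n1: "real n \<ge> 1" using n by simp
  have "(2 * real s - real n)\<^sup>2 \<le> (real n)\<^sup>2"
    using s by (intro abs_le_square_iff[THEN iffD1]) auto
  then have "v \<le> (real n)\<^sup>2 / real n"
    unfolding v_def sq_dev_def by (intro divide_right_mono) auto
  then have v: "0 \<le> v" "v \<le> real n"
    using n by (simp_all add: v_def sq_dev_def power2_eq_square)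
  have v2: "v ^ 2 \<le> real n ^ 2" and v3: "v ^ 3 \<le> real n ^ 3" using v by (auto intro!: power_mono)
  have nn: "real n \<le> real n ^ 2" "1 \<le> real n ^ 2" "real n ^ 2 \<le> real n ^ 3"
    using n1 power_increasing[of 1 2 "real n"] power_increasing[of 0 2 "real n"] power_increasing[of 2 3 "real n"] by auto
  have "\<bar>v ^ 2 / 12 - v / 2 + 1/4\<bar> \<le> real n ^ 2"
    using v v2 nn zero_le_power2[of v] by linarith
  then have "\<bar>(v ^ 2 / 12 - v / 2 + 1/4) / real n\<bar> \<le> real n ^ 2 / real n"
    by (simp add: divide_right_mono)
  moreover have "\<bar>v ^ 3 / 30 - v ^ 2 / 4 + v / 3\<bar> \<le> real n ^ 3"
    using v v2 v3 nn zero_le_power2[of v] zero_le_power[OF v(1), of 3] by linarith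
  then have "\<bar>(v ^ 3 / 30 - v ^ 2 / 4 + v / 3) / real n ^ 2\<bar> \<le> real n ^ 3 / real n ^ 2"
    by (simp add: divide_right_mono)
  moreover have "real n ^ 2 / real n = real n" "real n ^ 3 / real n ^ 2 = real n"
    using n1 by (simp_all add: eval_nat_numeral)
  ultimately have "\<bar>surprise_expansion n v\<bar> \<le> 3 * real n"
    using v unfolding surprise_expansion_def by linarith
  moreover have "0 \<le> ln (pi * real n / 2)"
  proof -
    have "2 * 1 \<le> pi * real n" using n1 pi_ge_two by (intro mult_mono) auto
    then show ?thesis by simp
  qed
  moreover have "ln (pi * real n / 2) \<le> 2 * real n"
  proof -
    have "pi * real n \<le> 4 * real n" using pi_less_4 by (intro mult_right_mono) auto
    moreover have "ln (pi * real n / 2) \<le> pi * real n / 2 - 1"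
      using n by (intro ln_le_minus_one) simp
    ultimately show ?thesis by linarith
  qed
  ultimately show ?thesis
    using binomial_surprise_bounds[OF s] by (simp add: v_def abs_le_iff)
qed

lemma surprise_expansion_error:
  obtains C where "C \<ge> 0"
    "eventually (\<lambda>n. \<forall>s\<le>n.
       \<bar>binomial_surprise n s - ln (pi * real n / 2) / 2 - surprise_expansion n (sq_dev n s)\<bar>
         \<le> C * (1 + sq_dev n s ^ 4) / real n ^ 3) sequentially"
proof -
  obtain r C where r: "r > 0" "r \<le> 1/2" "C \<ge> 0"
    "eventually (\<lambda>n. \<forall>s\<le>n. \<bar>2 * real s - real n\<bar> < r * real n \<longrightarrow>
       \<bar>binomial_surprise n s - ln (pi * real n / 2) / 2 - surprise_expansion n (sq_dev n s)\<bar>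
         \<le> C * (1 + sq_dev n s ^ 4) / real n ^ 3) sequentially"
    by (rule surprise_expansion_central)
  \<comment> \<open>Outside the central range v \<ge> r^2 n, hence v^4 / n^3 \<ge> r^8 n; the factor
    5 / r^8 turns this into the crude bound 5 n.\<close>
  define K where "K = C + 5 / r ^ 8"
  have K: "C \<le> K" "5 / r ^ 8 \<le> K" using r by (simp_all add: K_def)
  have tail: "5 * real n \<le> K * (1 + sq_dev n s ^ 4) / real n ^ 3"
    if n: "n > 0" and s: "\<not> \<bar>2 * real s - real n\<bar> < r * real n" for n s
  proof -
    define v where "v = sq_dev n s"
    have "(r * real n)\<^sup>2 \<le> (2 * real s - real n)\<^sup>2"
      using s r by (intro abs_le_square_iff[THEN iffD1]) auto
    then have v: "r\<^sup>2 * real n \<le> v"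
      using n by (simp add: v_def sq_dev_def field_simps power2_eq_square)
    have "r ^ 8 * real n ^ 4 = (r\<^sup>2 * real n) ^ 4"
      by (simp add: power_mult_distrib power_mult[symmetric])
    also have "\<dots> \<le> v ^ 4" using v r by (intro power_mono) auto
    finally have "r ^ 8 * real n ^ 4 \<le> 1 + v ^ 4" by simp
    then have "5 / r ^ 8 * (r ^ 8 * real n ^ 4) \<le> K * (1 + v ^ 4)"
      using K r by (intro mult_mono) auto
    then have "5 * real n ^ 4 \<le> K * (1 + v ^ 4)" using r by simp
    then show ?thesis
      using n by (simp add: v_def field_simps eval_nat_numeral)
  qed
  show ?thesis
  proof
    show "K \<ge> 0" using K r by simp
    show "eventually (\<lambda>n. \<forall>s\<le>n.
       \<bar>binomial_surprise n s - ln (pi * real n / 2) / 2 - surprise_expansion n (sq_dev n s)\<bar>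
         \<le> K * (1 + sq_dev n s ^ 4) / real n ^ 3) sequentially"
      using r(4) eventually_gt_at_top[of 0]
    proof eventually_elim
      case (elim n)
      show ?case
      proof (intro allI impI)
        fix s assume s: "s \<le> n"
        show "\<bar>binomial_surprise n s - ln (pi * real n / 2) / 2 - surprise_expansion n (sq_dev n s)\<bar>
            \<le> K * (1 + sq_dev n s ^ 4) / real n ^ 3"
        proof (cases "\<bar>2 * real s - real n\<bar> < r * real n")
          case True
          have "C * (1 + sq_dev n s ^ 4) / real n ^ 3 \<le> K * (1 + sq_dev n s ^ 4) / real n ^ 3"
            using K elim by (intro divide_right_mono mult_right_mono) auto
          then show ?thesis using elim(1) s True by fastforce
        next
          case False
          then show ?thesis
            using tail[OF elim(2), of s] surprise_expansion_crude[OF elim(2) s] by linarith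
        qed
      qed
    qed
  qed
qed

section \<open>Moments of the symmetric binomial law\<close>

text \<open>2S - n is a simple symmetric random walk; this is the average over one additional step
  of size 1 up or down.\<close>

lemma binomial_mean_half_Suc_centred:
  "binomial_mean (Suc n) (1/2) (\<lambda>s. f (2 * real s - real (Suc n)))
    = binomial_mean n (1/2) (\<lambda>s. (f (2 * real s - real n + 1) + f (2 * real s - real n - 1)) / 2)"
proof -
  have eq: "2 * real s - real (Suc n) = 2 * real s - real n - 1"
    "2 * real (Suc s) - real (Suc n) = 2 * real s - real n + 1" for s
    by simp_all
  have half: "(x + y) / 2 = 1/2 * x + 1/2 * y" for x y :: real by simp
  show ?thesis
    unfolding binomial_mean_Suc eq(2) unfolding eq(1) half binomial_mean_add binomial_mean_cmult by simp
qed

text \<open>Averaging (t + 1)^j and (t - 1)^j for even j leaves even powers only, so the even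
  moments obey a triangular recursion in n.\<close>

lemma centred_moments:
  "binomial_mean n (1/2) (\<lambda>s. (2 * real s - real n) ^ 2) = real n"
  "binomial_mean n (1/2) (\<lambda>s. (2 * real s - real n) ^ 4) = 3 * real n ^ 2 - 2 * real n"
  "binomial_mean n (1/2) (\<lambda>s. (2 * real s - real n) ^ 6) = 15 * real n ^ 3 - 30 * real n ^ 2 + 16 * real n"
  "binomial_mean n (1/2) (\<lambda>s. (2 * real s - real n) ^ 8)
    = 105 * real n ^ 4 - 420 * real n ^ 3 + 588 * real n ^ 2 - 272 * real n"
proof -
  define M where "M j n = binomial_mean n (1/2) (\<lambda>s. (2 * real s - real n) ^ j)" for j n
  have M0: "M j 0 = 0" if "j > 0" for j
    using that by (simp add: M_def binomial_mean_0)
  have p2: "((t + 1) ^ 2 + (t - 1) ^ 2) / 2 = t ^ 2 + 1"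
    and p4: "((t + 1) ^ 4 + (t - 1) ^ 4) / 2 = t ^ 4 + 6 * t ^ 2 + 1"
    and p6: "((t + 1) ^ 6 + (t - 1) ^ 6) / 2 = t ^ 6 + 15 * t ^ 4 + 15 * t ^ 2 + 1"
    and p8: "((t + 1) ^ 8 + (t - 1) ^ 8) / 2 = t ^ 8 + 28 * t ^ 6 + 70 * t ^ 4 + 28 * t ^ 2 + 1" for t :: real
    by (simp_all add: eval_nat_numeral algebra_simps)
  have M2: "M 2 (Suc n) = M 2 n + 1"
    and M4: "M 4 (Suc n) = M 4 n + 6 * M 2 n + 1"
    and M6: "M 6 (Suc n) = M 6 n + 15 * M 4 n + 15 * M 2 n + 1"
    and M8: "M 8 (Suc n) = M 8 n + 28 * M 6 n + 70 * M 4 n + 28 * M 2 n + 1" for n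
    unfolding M_def
      binomial_mean_half_Suc_centred[of n "\<lambda>t. t ^ 2"] binomial_mean_half_Suc_centred[of n "\<lambda>t. t ^ 4"]
      binomial_mean_half_Suc_centred[of n "\<lambda>t. t ^ 6"] binomial_mean_half_Suc_centred[of n "\<lambda>t. t ^ 8"]
      p2 p4 p6 p8
    by (simp_all add: binomial_mean_add binomial_mean_cmult binomial_mean_const)
  have E2: "M 2 n = real n" for n
    by (induction n) (simp_all add: M0 M2)
  have E4: "M 4 n = 3 * real n ^ 2 - 2 * real n" for n
    by (induction n) (simp_all add: M0 M4 E2 power2_eq_square power3_eq_cube power4_eq_xxxx algebra_simps)
  have E6: "M 6 n = 15 * real n ^ 3 - 30 * real n ^ 2 + 16 * real n" for n
    by (induction n) (simp_all add: M0 M6 E4 E2 power2_eq_square power3_eq_cube power4_eq_xxxx algebra_simps)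
  have E8: "M 8 n = 105 * real n ^ 4 - 420 * real n ^ 3 + 588 * real n ^ 2 - 272 * real n" for n
    by (induction n) (simp_all add: M0 M8 E6 E4 E2 power2_eq_square power3_eq_cube power4_eq_xxxx algebra_simps)
  show "binomial_mean n (1/2) (\<lambda>s. (2 * real s - real n) ^ 2) = real n"
    "binomial_mean n (1/2) (\<lambda>s. (2 * real s - real n) ^ 4) = 3 * real n ^ 2 - 2 * real n"
    "binomial_mean n (1/2) (\<lambda>s. (2 * real s - real n) ^ 6) = 15 * real n ^ 3 - 30 * real n ^ 2 + 16 * real n"
    "binomial_mean n (1/2) (\<lambda>s. (2 * real s - real n) ^ 8)
      = 105 * real n ^ 4 - 420 * real n ^ 3 + 588 * real n ^ 2 - 272 * real n"
    using E2[of n] E4[of n] E6[of n] E8[of n] by (simp_all only: M_def)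
qed

lemma sq_dev_moments:
  assumes "n > 0"
  shows "binomial_mean n (1/2) (sq_dev n) = 1"
    "binomial_mean n (1/2) (\<lambda>s. sq_dev n s ^ 2) = 3 - 2 / real n"
    "binomial_mean n (1/2) (\<lambda>s. sq_dev n s ^ 3) = 15 - 30 / real n + 16 / real n ^ 2"
    "binomial_mean n (1/2) (\<lambda>s. sq_dev n s ^ 4) = 105 - 420 / real n + 588 / real n ^ 2 - 272 / real n ^ 3"
proof -
  have eq: "sq_dev n s ^ j = 1 / real n ^ j * (2 * real s - real n) ^ (2 * j)" for s j
    by (simp add: sq_dev_def power_divide power_mult)
  have m: "binomial_mean n (1/2) (\<lambda>s. sq_dev n s ^ j)
      = 1 / real n ^ j * binomial_mean n (1/2) (\<lambda>s. (2 * real s - real n) ^ (2 * j))" for j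
    unfolding eq binomial_mean_cmult ..
  show "binomial_mean n (1/2) (sq_dev n) = 1"
    using m[of 1] assms centred_moments(1)[of n] by simp
  show "binomial_mean n (1/2) (\<lambda>s. sq_dev n s ^ 2) = 3 - 2 / real n"
    unfolding m using assms by (simp add: centred_moments(2)) (simp add: field_simps power2_eq_square)
  show "binomial_mean n (1/2) (\<lambda>s. sq_dev n s ^ 3) = 15 - 30 / real n + 16 / real n ^ 2"
    unfolding m using assms
    by (simp add: centred_moments(3)) (simp add: field_simps power2_eq_square power3_eq_cube)
  show "binomial_mean n (1/2) (\<lambda>s. sq_dev n s ^ 4) = 105 - 420 / real n + 588 / real n ^ 2 - 272 / real n ^ 3"
    unfolding m using assms
    by (simp add: centred_moments(4)) (simp add: field_simps power2_eq_square power3_eq_cube power4_eq_xxxx)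
qed

section \<open>Moment bounds uniform in n\<close>

lemma binomial_mean_exp_centred:
  "binomial_mean n (1/2) (\<lambda>s. exp (t * (2 * real s - real n))) = ((exp t + exp (- t)) / 2) ^ n"
proof (induction n)
  case (Suc n)
  have "(exp (t * (y + 1)) + exp (t * (y - 1))) / 2 = (exp t + exp (- t)) / 2 * exp (t * y)" for y
    by (simp add: algebra_simps exp_add exp_diff exp_minus field_simps)
  then show ?case
    unfolding binomial_mean_half_Suc_centred[of n "\<lambda>y. exp (t * y)"]
    by (simp only: binomial_mean_cmult Suc.IH power_Suc)
qed (simp add: binomial_mean_0)

lemma exp_plus_exp_minus_le:
  fixes t :: real
  assumes "0 \<le> t" "t \<le> 1"
  shows "(exp t + exp (- t)) / 2 \<le> 1 + t\<^sup>2"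
proof -
  have "exp t \<le> 1 + t + t\<^sup>2" using assms by (rule exp_bound)
  moreover have "exp (- t) \<le> 1 - t + t\<^sup>2"
  proof -
    \<comment> \<open>The factorisation of 1 + t^3 together with 1 + t \<le> exp t bounds exp (-t)
      without a series.\<close>
    have "1 \<le> 1 + t ^ 3" using assms by simp
    also have "1 + t ^ 3 = (1 - t + t\<^sup>2) * (1 + t)"
      by (simp add: algebra_simps power2_eq_square power3_eq_cube)
    also have "\<dots> \<le> (1 - t + t\<^sup>2) * exp t"
      using assms by (intro mult_left_mono) (auto simp: add_nonneg_nonneg)
    finally show ?thesis by (simp add: exp_minus field_simps)
  qed
  ultimately show ?thesis by simp
qed

text \<open>The generating function at t = 1 / sqrt n is at most (1 + 1/n)^n \<le> e, whatever n is,
  and an exponential dominates each power. The factor 2 accounts for both signs of the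
  deviation.\<close>

lemma sq_dev_moment_bound:
  assumes "n > 0"
  shows "binomial_mean n (1/2) (\<lambda>s. sq_dev n s ^ j) \<le> 2 * exp 1 * fact (2 * j)"
proof -
  define t where "t = 1 / sqrt (real n)"
  have t: "0 \<le> t" "t \<le> 1" "t\<^sup>2 = 1 / real n"
    using assms by (simp_all add: t_def power_divide)
  have pt: "sq_dev n s ^ j \<le> fact (2 * j) * (exp (t * (2 * real s - real n)) + exp (- t * (2 * real s - real n)))" for s
  proof -
    define y where "y = t * (2 * real s - real n)"
    have "sq_dev n s = y\<^sup>2" by (simp add: y_def sq_dev_def power_mult_distrib t)
    then have "sq_dev n s ^ j = \<bar>y\<bar> ^ (2 * j)" by (simp add: power_mult)
    also have "\<dots> \<le> fact (2 * j) * exp \<bar>y\<bar>"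
    proof -
      \<comment> \<open>A single term of the exponential series is at most the whole sum.\<close>
      have "(\<Sum>i\<in>{2 * j}. \<bar>y\<bar> ^ i /\<^sub>R fact i) \<le> exp \<bar>y\<bar>"
        unfolding exp_def by (rule sum_le_suminf[OF summable_exp_generic]) auto
      then show ?thesis by (simp add: field_simps)
    qed
    also have "\<dots> \<le> fact (2 * j) * (exp y + exp (- y))"
      by (intro mult_left_mono) (auto simp: abs_if)
    finally show ?thesis by (simp add: y_def)
  qed
  have "((exp t + exp (- t)) / 2) ^ n \<le> (1 + 1 / real n) ^ n"
    using exp_plus_exp_minus_le[OF t(1,2)] t(3) by (intro power_mono) auto
  also have "\<dots> \<le> exp (1 / real n) ^ n"
    by (intro power_mono exp_ge_add_one_self) (simp add: add_nonneg_nonneg)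
  also have "\<dots> = exp 1" using assms by (simp flip: exp_of_nat_mult)
  finally have mgf: "((exp t + exp (- t)) / 2) ^ n \<le> exp 1" .
  have "binomial_mean n (1/2) (\<lambda>s. sq_dev n s ^ j) \<le> binomial_mean n (1/2)
      (\<lambda>s. fact (2 * j) * (exp (t * (2 * real s - real n)) + exp (- t * (2 * real s - real n))))"
    using pt by (intro binomial_mean_mono) auto
  also have "\<dots> = fact (2 * j) * (2 * ((exp t + exp (- t)) / 2) ^ n)"
    unfolding binomial_mean_cmult binomial_mean_add binomial_mean_exp_centred by (simp add: add.commute)
  also have "\<dots> \<le> fact (2 * j) * (2 * exp 1)"
    using mgf by (intro mult_left_mono) auto
  finally show ?thesis by (simp add: mult_ac)
qed

text \<open>The exponent 8 accommodates the square of an error of weight (1 + v)^4; one weight then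
  serves both the mean and the second moment.\<close>

lemma sq_dev_weight_bound:
  obtains B where "B \<ge> 0" "\<And>n. n > 0 \<Longrightarrow> binomial_mean n (1/2) (\<lambda>s. (1 + sq_dev n s) ^ 8) \<le> B"
proof
  define B :: real where "B = 2 ^ 8 * (1 + 2 * exp 1 * fact (2 * 8))"
  show "B \<ge> 0" by (simp add: B_def)
  show "binomial_mean n (1/2) (\<lambda>s. (1 + sq_dev n s) ^ 8) \<le> B" if "n > 0" for n
  proof -
    have "(1 + sq_dev n s) ^ 8 \<le> 2 ^ 8 * (1 + sq_dev n s ^ 8)" for s
    proof -
      have v: "0 \<le> sq_dev n s" by (simp add: sq_dev_def)
      have "(1 + sq_dev n s) ^ 8 \<le> (2 * max 1 (sq_dev n s)) ^ 8"
        using v by (intro power_mono) auto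
      also have "\<dots> = 2 ^ 8 * (max 1 (sq_dev n s)) ^ 8" by (rule power_mult_distrib)
      also have "\<dots> \<le> 2 ^ 8 * (1 + sq_dev n s ^ 8)"
        using v by (intro mult_left_mono) (auto simp: max_def)
      finally show ?thesis .
    qed
    then have "binomial_mean n (1/2) (\<lambda>s. (1 + sq_dev n s) ^ 8)
        \<le> binomial_mean n (1/2) (\<lambda>s. 2 ^ 8 * (1 + sq_dev n s ^ 8))"
      by (intro binomial_mean_mono) auto
    also have "\<dots> = 2 ^ 8 * (1 + binomial_mean n (1/2) (\<lambda>s. sq_dev n s ^ 8))"
      unfolding binomial_mean_cmult binomial_mean_add binomial_mean_const ..
    also have "\<dots> \<le> B"
      unfolding B_def using sq_dev_moment_bound[OF that, of 8] by (intro mult_left_mono add_left_mono) auto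
    finally show ?thesis .
  qed
qed

section \<open>Mean and second moment of the surprise\<close>

lemma coeff_entropy_half:
  "coeff_entropy n (adder_gf (\<lambda>_. 1/2) {..<n}) = binomial_mean n (1/2) (binomial_surprise n)"
  by (simp add: coeff_entropy_def binomial_mean_def coeff_adder_gf_const binomial_surprise_def sum_negf)

lemma sum_coeff_ln_square_half:
  "(\<Sum>s\<le>n. coeff (adder_gf (\<lambda>_. 1/2) {..<n}) s * (ln (coeff (adder_gf (\<lambda>_. 1/2) {..<n}) s))\<^sup>2)
    = binomial_mean n (1/2) (\<lambda>s. (binomial_surprise n s)\<^sup>2)"
  by (simp add: binomial_mean_def coeff_adder_gf_const binomial_surprise_def)

lemma binomial_mean_error:
  assumes K: "K \<ge> 0" and ev: "eventually (\<lambda>n. \<forall>s\<le>n. \<bar>F n s - P n s\<bar> \<le> K * (1 + sq_dev n s) ^ 8 / real n ^ 3) sequentially"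
  shows "(\<lambda>n. binomial_mean n (1/2) (F n) - binomial_mean n (1/2) (P n)) \<in> O(\<lambda>n. 1 / real n ^ 3)"
proof -
  obtain B where B: "B \<ge> 0" "\<And>n. n > 0 \<Longrightarrow> binomial_mean n (1/2) (\<lambda>s. (1 + sq_dev n s) ^ 8) \<le> B"
    by (rule sq_dev_weight_bound) blast
  show ?thesis
  proof (rule bigoI)
    show "eventually (\<lambda>n. norm (binomial_mean n (1/2) (F n) - binomial_mean n (1/2) (P n))
        \<le> K * B * norm (1 / real n ^ 3)) sequentially"
      using ev eventually_gt_at_top[of 0]
    proof eventually_elim
      case (elim n)
      let ?W = "binomial_mean n (1/2) (\<lambda>s. K / real n ^ 3 * (1 + sq_dev n s) ^ 8)"
      have "binomial_mean n (1/2) (\<lambda>s. F n s - P n s) \<le> ?W"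
        "binomial_mean n (1/2) (\<lambda>s. P n s - F n s) \<le> ?W"
        using elim(1) by (auto intro!: binomial_mean_mono simp: abs_le_iff)
      then have "\<bar>binomial_mean n (1/2) (F n) - binomial_mean n (1/2) (P n)\<bar> \<le> ?W"
        unfolding binomial_mean_diff by linarith
      also have "\<dots> = K / real n ^ 3 * binomial_mean n (1/2) (\<lambda>s. (1 + sq_dev n s) ^ 8)"
        by (rule binomial_mean_cmult)
      also have "\<dots> \<le> K / real n ^ 3 * B"
        using K B(2)[OF elim(2)] by (intro mult_left_mono) auto
      finally show ?case by simp
    qed
  qed
qed

text \<open>Applied with x = 1/n and w = 1 + v; the powers of w follow the degrees in v of the three
  coefficients. The 3 comes from 2BE x^3 and E^2 x^4, the 6C from twice the remainder times a main
  part of size at most 3 w^3, the C^2 from the squared remainder.\<close>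

lemma square_expansion_error:
  fixes A B E R w x C :: real
  assumes w: "1 \<le> w" and x: "0 \<le> x" "x \<le> 1" and C: "0 \<le> C"
    and A: "\<bar>A\<bar> \<le> w" and B: "\<bar>B\<bar> \<le> w ^ 2" and E: "\<bar>E\<bar> \<le> w ^ 3" and R: "\<bar>R\<bar> \<le> C * w ^ 4 * x ^ 3"
  shows "\<bar>(A + B * x + E * x ^ 2 + R) ^ 2 - (A ^ 2 + 2 * A * B * x + (B ^ 2 + 2 * A * E) * x ^ 2)\<bar>
    \<le> (3 + 6 * C + C ^ 2) * w ^ 8 * x ^ 3"
proof -
  define Q where "Q = A + B * x + E * x ^ 2"
  have wp: "w ^ i \<le> w ^ j" if "i \<le> j" for i j using w that by (intro power_increasing) auto
  have xp: "x ^ i \<le> x ^ j" if "j \<le> i" for i j using x that by (intro power_decreasing) auto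
  have x1: "x ^ i \<le> 1" for i using x by (intro power_le_one) auto
  have "\<bar>2 * (B * E) * x ^ 3\<bar> \<le> 2 * w ^ 8 * x ^ 3"
  proof -
    have "\<bar>B * E\<bar> \<le> w ^ 2 * w ^ 3" unfolding abs_mult using B E w by (intro mult_mono) auto
    also have "\<dots> \<le> w ^ 8" using wp[of 5 8] by (simp flip: power_add)
    finally show ?thesis using x by (simp add: abs_mult mult_right_mono)
  qed
  moreover have "\<bar>E ^ 2 * x ^ 4\<bar> \<le> w ^ 8 * x ^ 3"
  proof -
    have "\<bar>E\<bar> ^ 2 \<le> (w ^ 3) ^ 2" using E by (intro power_mono) auto
    also have "\<dots> \<le> w ^ 8" using wp[of 6 8] by (simp flip: power_mult)
    finally show ?thesis using xp[of 3 4] x w by (simp add: abs_mult mult_mono)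
  qed
  moreover have "\<bar>2 * Q * R\<bar> \<le> 6 * C * w ^ 8 * x ^ 3"
  proof -
    have "\<bar>Q\<bar> \<le> \<bar>A\<bar> + \<bar>B\<bar> * x + \<bar>E\<bar> * x ^ 2"
      unfolding Q_def using x by (intro order.trans[OF abs_triangle_ineq] add_mono) (auto simp: abs_mult)
    also have "\<dots> \<le> w ^ 3 + w ^ 3 * 1 + w ^ 3 * 1"
      using A B E wp[of 1 3] wp[of 2 3] x x1[of 2] w by (intro add_mono mult_mono) auto
    finally have "\<bar>Q\<bar> \<le> 3 * w ^ 3" by simp
    then have "\<bar>Q\<bar> * \<bar>R\<bar> \<le> (3 * w ^ 3) * (C * w ^ 4 * x ^ 3)"
      using R w by (intro mult_mono) auto
    also have "\<dots> = 3 * C * x ^ 3 * w ^ 7" by (simp add: eval_nat_numeral)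
    also have "\<dots> \<le> 3 * C * x ^ 3 * w ^ 8" using wp[of 7 8] C x by (intro mult_left_mono) auto
    finally show ?thesis by (simp add: abs_mult mult_ac)
  qed
  moreover have "\<bar>R ^ 2\<bar> \<le> C ^ 2 * w ^ 8 * x ^ 3"
  proof -
    have "\<bar>R\<bar> ^ 2 \<le> (C * w ^ 4 * x ^ 3) ^ 2" using R by (intro power_mono) auto
    also have "\<dots> = C ^ 2 * w ^ 8 * x ^ 6" by (simp add: power_mult_distrib flip: power_mult)
    also have "\<dots> \<le> C ^ 2 * w ^ 8 * x ^ 3" using xp[of 3 6] w by (intro mult_left_mono) auto
    finally show ?thesis by simp
  qed
  moreover have "(A + B * x + E * x ^ 2 + R) ^ 2 - (A ^ 2 + 2 * A * B * x + (B ^ 2 + 2 * A * E) * x ^ 2)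
      = 2 * (B * E) * x ^ 3 + E ^ 2 * x ^ 4 + 2 * Q * R + R ^ 2"
    unfolding Q_def by (simp add: power2_eq_square power3_eq_cube power4_eq_xxxx algebra_simps)
  ultimately show ?thesis
    unfolding distrib_right by linarith
qed

lemma bigo_ev_eq:
  "eventually (\<lambda>x. f x = g x) F \<Longrightarrow> g \<in> O[F](h) \<Longrightarrow> f \<in> O[F](h)"
  using landau_o.big.in_cong by blast

lemma bigo_diff_trans:
  fixes f g k :: "'a \<Rightarrow> real"
  assumes "(\<lambda>x. f x - g x) \<in> O[F](h)" "(\<lambda>x. g x - k x) \<in> O[F](h)"
  shows "(\<lambda>x. f x - k x) \<in> O[F](h)"
  using sum_in_bigo(1)[OF assms] by simp

lemma bigo_cmult: "f \<in> O[F](g) \<Longrightarrow> (\<lambda>x. c * f x) \<in> O[F](g)" for c :: real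
  using landau_o.big.mult[of "\<lambda>_. c" F "\<lambda>_. 1" f g] by simp

text \<open>Removing the deterministic logarithm leaves the variance unchanged and keeps the first
  two moments bounded, so no terms in ln n have to cancel later.\<close>

definition surprise_dev :: "nat \<Rightarrow> nat \<Rightarrow> real" where
  "surprise_dev n s = binomial_surprise n s - ln (pi * real n / 2) / 2"

lemma one_plus_power4_le: "0 \<le> v \<Longrightarrow> 1 + v ^ 4 \<le> (1 + v) ^ 4" for v :: real
  by (simp add: eval_nat_numeral algebra_simps)

text \<open>Inserting the exact moments, the 1/n terms -1/2 + 1/4 + 1/4 cancel, and the 1/n^2 terms
  1/3 - 1/6 - 3/4 + 1/2 give -1/12.\<close>

lemma surprise_dev_mean:
  "(\<lambda>n. binomial_mean n (1/2) (surprise_dev n) - (1/2 - 1 / (12 * real n ^ 2))) \<in> O(\<lambda>n. 1 / real n ^ 3)"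
proof -
  let ?P = "\<lambda>n s. surprise_expansion n (sq_dev n s)"
  obtain C where C: "C \<ge> 0" "eventually (\<lambda>n. \<forall>s\<le>n.
       \<bar>binomial_surprise n s - ln (pi * real n / 2) / 2 - ?P n s\<bar>
         \<le> C * (1 + sq_dev n s ^ 4) / real n ^ 3) sequentially"
    by (rule surprise_expansion_error)
  have "eventually (\<lambda>n. \<forall>s\<le>n. \<bar>surprise_dev n s - ?P n s\<bar> \<le> C * (1 + sq_dev n s) ^ 8 / real n ^ 3) sequentially"
    using C(2)
  proof eventually_elim
    case (elim n)
    have "1 + sq_dev n s ^ 4 \<le> (1 + sq_dev n s) ^ 8" for s
    proof -
      have v: "0 \<le> sq_dev n s" by (simp add: sq_dev_def)
      have "1 + sq_dev n s ^ 4 \<le> (1 + sq_dev n s) ^ 4" using v by (rule one_plus_power4_le)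
      also have "\<dots> \<le> (1 + sq_dev n s) ^ 8" using v by (intro power_increasing) auto
      finally show ?thesis .
    qed
    then have "C * (1 + sq_dev n s ^ 4) / real n ^ 3 \<le> C * (1 + sq_dev n s) ^ 8 / real n ^ 3" for s
      using C(1) by (intro divide_right_mono mult_left_mono) auto
    then show ?case using elim unfolding surprise_dev_def by (meson order.trans)
  qed
  from binomial_mean_error[OF C(1) this]
  have 1: "(\<lambda>n. binomial_mean n (1/2) (surprise_dev n) - binomial_mean n (1/2) (?P n)) \<in> O(\<lambda>n. 1 / real n ^ 3)" .
  have P: "?P n s = (1/2 - 1 / (2 * real n) + 1 / (3 * real n ^ 2)) * sq_dev n s
      + (1 / (12 * real n) - 1 / (4 * real n ^ 2)) * sq_dev n s ^ 2
      + 1 / (30 * real n ^ 2) * sq_dev n s ^ 3 + 1 / (4 * real n)" for n s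
    by (simp add: surprise_expansion_def algebra_simps add_divide_distrib diff_divide_distrib)
  have "(\<lambda>n. binomial_mean n (1/2) (?P n) - (1/2 - 1 / (12 * real n ^ 2))) \<in> O(\<lambda>n. 1 / real n ^ 3)"
  proof (rule bigo_ev_eq)
    show "eventually (\<lambda>n. binomial_mean n (1/2) (?P n) - (1/2 - 1 / (12 * real n ^ 2))
      = (1/2 - 1 / (2 * real n) + 1 / (3 * real n ^ 2)) * 1
      + (1 / (12 * real n) - 1 / (4 * real n ^ 2)) * (3 - 2 / real n)
      + 1 / (30 * real n ^ 2) * (15 - 30 / real n + 16 / real n ^ 2) + 1 / (4 * real n)
      - (1/2 - 1 / (12 * real n ^ 2))) sequentially"
      using eventually_gt_at_top[of 0]
      by eventually_elim
        (simp only: P binomial_mean_add binomial_mean_cmult binomial_mean_const sq_dev_moments)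
    show "(\<lambda>n. (1/2 - 1 / (2 * real n) + 1 / (3 * real n ^ 2)) * 1
      + (1 / (12 * real n) - 1 / (4 * real n ^ 2)) * (3 - 2 / real n)
      + 1 / (30 * real n ^ 2) * (15 - 30 / real n + 16 / real n ^ 2) + 1 / (4 * real n)
      - (1/2 - 1 / (12 * real n ^ 2))) \<in> O(\<lambda>n. 1 / real n ^ 3)"
      by real_asymp
  qed
  with 1 show ?thesis by (rule bigo_diff_trans)
qed

lemma surprise_dev_second_moment:
  "(\<lambda>n. binomial_mean n (1/2) (\<lambda>s. (surprise_dev n s)\<^sup>2) - (3/4 - 1 / (2 * real n) - 7 / (12 * real n ^ 2)))
    \<in> O(\<lambda>n. 1 / real n ^ 3)"
proof -
  let ?A = "\<lambda>v. v / 2 :: real" and ?B = "\<lambda>v. v ^ 2 / 12 - v / 2 + 1/4 :: real"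
    and ?E = "\<lambda>v. v ^ 3 / 30 - v ^ 2 / 4 + v / 3 :: real"
  \<comment> \<open>The square of the expansion truncated after x^2. Both ?B^2 and 2 ?A ?E have
    degree 4 in v, with joint leading coefficient 1/144 + 1/30 = 29/720.\<close>
  define P where "P n s = (let v = sq_dev n s; x = 1 / real n in
    ?A v ^ 2 + 2 * ?A v * ?B v * x + (?B v ^ 2 + 2 * ?A v * ?E v) * x ^ 2)" for n s
  obtain C where C: "C \<ge> 0" "eventually (\<lambda>n. \<forall>s\<le>n.
       \<bar>binomial_surprise n s - ln (pi * real n / 2) / 2 - surprise_expansion n (sq_dev n s)\<bar>
         \<le> C * (1 + sq_dev n s ^ 4) / real n ^ 3) sequentially"
    by (rule surprise_expansion_error)
  have "eventually (\<lambda>n. \<forall>s\<le>n. \<bar>(surprise_dev n s)\<^sup>2 - P n s\<bar>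
      \<le> (3 + 6 * C + C ^ 2) * (1 + sq_dev n s) ^ 8 / real n ^ 3) sequentially"
    using C(2) eventually_gt_at_top[of 0]
  proof eventually_elim
    case (elim n)
    show ?case
    proof (intro allI impI)
      fix s assume "s \<le> n"
      define v where "v = sq_dev n s"
      define x where "x = 1 / real n"
      define R where "R = surprise_dev n s - surprise_expansion n v"
      have v: "0 \<le> v" by (simp add: v_def sq_dev_def)
      have v2: "0 \<le> v ^ 2" and v3: "0 \<le> v ^ 3" using v by simp_all
      have x: "0 \<le> x" "x \<le> 1" using elim(2) by (simp_all add: x_def)
      have w2: "(1 + v) ^ 2 = 1 + 2 * v + v ^ 2" and w3: "(1 + v) ^ 3 = 1 + 3 * v + 3 * v ^ 2 + v ^ 3"
        by (simp_all add: power2_eq_square power3_eq_cube algebra_simps)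
      have "\<bar>R\<bar> \<le> C * (1 + v ^ 4) / real n ^ 3"
        using elim(1) \<open>s \<le> n\<close> by (simp add: R_def v_def surprise_dev_def)
      also have "\<dots> \<le> C * (1 + v) ^ 4 / real n ^ 3"
        using C(1) one_plus_power4_le[OF v] by (intro divide_right_mono mult_left_mono) auto
      also have "\<dots> = C * (1 + v) ^ 4 * x ^ 3" by (simp add: x_def power_divide)
      finally have R: "\<bar>R\<bar> \<le> C * (1 + v) ^ 4 * x ^ 3" .
      have "\<bar>(?A v + ?B v * x + ?E v * x ^ 2 + R) ^ 2
          - (?A v ^ 2 + 2 * ?A v * ?B v * x + (?B v ^ 2 + 2 * ?A v * ?E v) * x ^ 2)\<bar>
          \<le> (3 + 6 * C + C ^ 2) * (1 + v) ^ 8 * x ^ 3"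
      proof (rule square_expansion_error)
        show "\<bar>?B v\<bar> \<le> (1 + v) ^ 2" unfolding w2 using v v2 by linarith
        show "\<bar>?E v\<bar> \<le> (1 + v) ^ 3" unfolding w3 using v v2 v3 by linarith
      qed (use v x C R in auto)
      moreover have "?A v + ?B v * x + ?E v * x ^ 2 + R = surprise_dev n s"
        by (simp add: R_def surprise_expansion_def x_def power_divide)
      ultimately show "\<bar>(surprise_dev n s)\<^sup>2 - P n s\<bar> \<le> (3 + 6 * C + C ^ 2) * (1 + sq_dev n s) ^ 8 / real n ^ 3"
        by (simp add: P_def Let_def v_def x_def power_divide)
    qed
  qed
  from binomial_mean_error[OF _ this] C(1)
  have 1: "(\<lambda>n. binomial_mean n (1/2) (\<lambda>s. (surprise_dev n s)\<^sup>2) - binomial_mean n (1/2) (P n)) \<in> O(\<lambda>n. 1 / real n ^ 3)"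
    by simp
  have P: "P n s = (1 / (4 * real n) - 1 / (4 * real n ^ 2)) * sq_dev n s
      + (1/4 - 1 / (2 * real n) + 5 / (8 * real n ^ 2)) * sq_dev n s ^ 2
      + (1 / (12 * real n) - 1 / (3 * real n ^ 2)) * sq_dev n s ^ 3
      + 29 / (720 * real n ^ 2) * sq_dev n s ^ 4 + 1 / (16 * real n ^ 2)" for n s
  proof -
    have alg: "?A v ^ 2 + 2 * ?A v * ?B v * x + (?B v ^ 2 + 2 * ?A v * ?E v) * x ^ 2
      = (x / 4 - x ^ 2 / 4) * v + (1/4 - x / 2 + 5 * x ^ 2 / 8) * v ^ 2 + (x / 12 - x ^ 2 / 3) * v ^ 3
        + 29 * x ^ 2 / 720 * v ^ 4 + x ^ 2 / 16" for v x :: real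
      by (simp add: field_simps power2_eq_square power3_eq_cube power4_eq_xxxx)
    show ?thesis unfolding P_def Let_def alg by (simp add: power_divide mult.commute)
  qed
  have "(\<lambda>n. binomial_mean n (1/2) (P n) - (3/4 - 1 / (2 * real n) - 7 / (12 * real n ^ 2))) \<in> O(\<lambda>n. 1 / real n ^ 3)"
  proof (rule bigo_ev_eq)
    show "eventually (\<lambda>n. binomial_mean n (1/2) (P n) - (3/4 - 1 / (2 * real n) - 7 / (12 * real n ^ 2))
      = (1 / (4 * real n) - 1 / (4 * real n ^ 2)) * 1
      + (1/4 - 1 / (2 * real n) + 5 / (8 * real n ^ 2)) * (3 - 2 / real n)
      + (1 / (12 * real n) - 1 / (3 * real n ^ 2)) * (15 - 30 / real n + 16 / real n ^ 2)
      + 29 / (720 * real n ^ 2) * (105 - 420 / real n + 588 / real n ^ 2 - 272 / real n ^ 3)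
      + 1 / (16 * real n ^ 2) - (3/4 - 1 / (2 * real n) - 7 / (12 * real n ^ 2))) sequentially"
      using eventually_gt_at_top[of 0]
      by eventually_elim
        (simp only: P[abs_def] binomial_mean_add binomial_mean_cmult binomial_mean_const sq_dev_moments)
    show "(\<lambda>n. (1 / (4 * real n) - 1 / (4 * real n ^ 2)) * 1
      + (1/4 - 1 / (2 * real n) + 5 / (8 * real n ^ 2)) * (3 - 2 / real n)
      + (1 / (12 * real n) - 1 / (3 * real n ^ 2)) * (15 - 30 / real n + 16 / real n ^ 2)
      + 29 / (720 * real n ^ 2) * (105 - 420 / real n + 588 / real n ^ 2 - 272 / real n ^ 3)
      + 1 / (16 * real n ^ 2) - (3/4 - 1 / (2 * real n) - 7 / (12 * real n ^ 2))) \<in> O(\<lambda>n. 1 / real n ^ 3)"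
      by real_asymp
  qed
  with 1 show ?thesis by (rule bigo_diff_trans)
qed

section \<open>Assembly of optimality, mutual information and dispersion\<close>

theorem theorem6:
  fixes \<delta> :: real
  assumes "0 \<le> \<delta>" and "\<delta> \<le> 1"
  shows "(\<forall>k p. (\<forall>i<k. 0 \<le> p i \<and> p i \<le> 1) \<longrightarrow> rac_MI k \<delta> p \<le> rac_MI k \<delta> (\<lambda>_. 1/2))
    \<and> ((\<lambda>k::nat. rac_MI k \<delta> (\<lambda>_. 1/2)
           - (1 - \<delta>) * (ln (pi * exp 1 * real k / 2) / 2 - 1 / (12 * (real k)\<^sup>2)))
         \<in> O(\<lambda>k. 1 / (real k)^3))
    \<and> ((\<lambda>k::nat. rac_V k \<delta> (\<lambda>_. 1/2)
           - (1 - \<delta>) * (\<delta> / 4 * (ln (pi * exp 1 * real k / 2))\<^sup>2 + 1/2 - 1 / (2 * real k)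
               - (1/2 + \<delta> * ln (pi * exp 1 * real k / 2) / 12) * (1 / (real k)\<^sup>2)))
         \<in> O(\<lambda>k. ln (real k) / (real k)^3))"
proof (intro conjI allI impI)
  fix k :: nat and p :: "nat \<Rightarrow> real"
  assume "\<forall>i<k. 0 \<le> p i \<and> p i \<le> 1"
  then show "rac_MI k \<delta> p \<le> rac_MI k \<delta> (\<lambda>_. 1/2)"
    unfolding rac_MI_eq using assms by (intro mult_left_mono coeff_entropy_le_half) auto
next
  define h where "h k = coeff_entropy k (adder_gf (\<lambda>_. 1/2) {..<k})" for k
  define a where "a k = ln (pi * real k / 2) / 2" for k :: nat
  define l where "l k = ln (pi * exp 1 * real k / 2)" for k :: nat
  define m1 where "m1 k = binomial_mean k (1/2) (surprise_dev k)" for k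
  define m2 where "m2 k = binomial_mean k (1/2) (\<lambda>s. (surprise_dev k s)\<^sup>2)" for k
  have bs: "binomial_surprise k s = a k + surprise_dev k s" for k s
    by (simp add: surprise_dev_def a_def)
  have h: "h k = a k + m1 k" for k
    unfolding h_def coeff_entropy_half m1_def
    using binomial_mean_add[of k "1/2" "\<lambda>_. a k" "surprise_dev k"]
    by (simp add: bs[abs_def] binomial_mean_const)
  have sq: "binomial_mean k (1/2) (\<lambda>s. (binomial_surprise k s)\<^sup>2) = (a k)\<^sup>2 + 2 * a k * m1 k + m2 k" for k
  proof -
    have "(binomial_surprise k s)\<^sup>2 = (a k)\<^sup>2 + 2 * a k * surprise_dev k s + (surprise_dev k s)\<^sup>2" for s
      unfolding bs by (simp add: power2_sum)
    then show ?thesis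
      by (simp add: binomial_mean_add binomial_mean_cmult binomial_mean_const m1_def m2_def)
  qed
  \<comment> \<open>As \<open>a k\<close> is constant, m2 - m1^2 is the variance of the unerased
    surprise; \<delta> h^2 is the spread between it and the erasure atom at 0.\<close>
  have V: "rac_V k \<delta> (\<lambda>_. 1/2) = (1 - \<delta>) * (m2 k - (m1 k)\<^sup>2 + \<delta> * (h k)\<^sup>2)" for k
    unfolding rac_V_eq sum_coeff_ln_square_half sq h_def[symmetric]
    by (simp add: h power2_eq_square algebra_simps)
  define r where "r k = h k - (l k / 2 - 1 / (12 * (real k)\<^sup>2))" for k
  have r1: "(\<lambda>k. m1 k - (1/2 - 1 / (12 * (real k)\<^sup>2))) \<in> O(\<lambda>k. 1 / real k ^ 3)"
    unfolding m1_def by (rule surprise_dev_mean)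
  have "eventually (\<lambda>k. r k = m1 k - (1/2 - 1 / (12 * (real k)\<^sup>2))) sequentially"
    using eventually_gt_at_top[of 0]
  proof eventually_elim
    case (elim k)
    \<comment> \<open>The factor e in the logarithm absorbs the limit 1/2 of
      \<open>m1 k\<close>.\<close>
    have "l k = ln (exp 1 * (pi * real k / 2))" by (simp add: l_def mult_ac)
    also have "\<dots> = 1 + 2 * a k" using elim by (subst ln_mult) (simp_all add: a_def)
    finally show ?case by (simp add: r_def h add_divide_distrib)
  qed
  from bigo_ev_eq[OF this r1] have r: "r \<in> O(\<lambda>k. 1 / real k ^ 3)" .
  have "(\<lambda>k. (1 - \<delta>) * r k) \<in> O(\<lambda>k. 1 / real k ^ 3)" using r by simp
  then show "(\<lambda>k::nat. rac_MI k \<delta> (\<lambda>_. 1/2)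
      - (1 - \<delta>) * (ln (pi * exp 1 * real k / 2) / 2 - 1 / (12 * (real k)\<^sup>2))) \<in> O(\<lambda>k. 1 / (real k)^3)"
    by (simp add: rac_MI_eq h_def[symmetric] r_def l_def right_diff_distrib)
  define t where "t k = 1/2 - 1 / (12 * (real k)\<^sup>2)" for k :: nat
  have lift: "f \<in> O(\<lambda>k. ln (real k) / real k ^ 3)" if "f \<in> O(\<lambda>k. 1 / real k ^ 3)" for f :: "nat \<Rightarrow> real"
    using that by (rule landau_o.big_trans) real_asymp
  have t1: "(\<lambda>k. 2 * t k) \<in> O(\<lambda>k. 1)" unfolding t_def by real_asymp
  have q1: "(\<lambda>k. m1 k - t k) \<in> O(\<lambda>k. 1 / real k ^ 3)" using r1 by (simp add: t_def)
  have one: "(\<lambda>k. 1 / real k ^ 3) \<in> O(\<lambda>k::nat. 1::real)" by real_asymp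
  have var: "(\<lambda>k. m2 k - (m1 k)\<^sup>2 - (1/2 - 1 / (2 * real k) - 1 / (2 * (real k)\<^sup>2))) \<in> O(\<lambda>k. 1 / real k ^ 3)"
  proof -
    have 1: "(\<lambda>k. m2 k - (3/4 - 1 / (2 * real k) - 7 / (12 * (real k)\<^sup>2))) \<in> O(\<lambda>k. 1 / real k ^ 3)"
      unfolding m2_def by (rule surprise_dev_second_moment)
    have 2: "(\<lambda>k. 2 * t k * (m1 k - t k)) \<in> O(\<lambda>k. 1 / real k ^ 3)"
      using landau_o.big.mult[OF t1 q1] by simp
    have 3: "(\<lambda>k. (m1 k - t k) * (m1 k - t k)) \<in> O(\<lambda>k. 1 / real k ^ 3)"
      using landau_o.big.mult[OF landau_o.big_trans[OF q1 one] q1] by simp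
    \<comment> \<open>Subtracting (t k)^2 turns 3/4 into 1/2 and -7/12 into -1/2; only the square of
      1 / (12 k^2) is left over.\<close>
    have "3/4 - 1 / (2 * real k) - 7 / (12 * (real k)\<^sup>2) - (t k)\<^sup>2
        - (1/2 - 1 / (2 * real k) - 1 / (2 * (real k)\<^sup>2)) = - (1 / (12 * (real k)\<^sup>2))\<^sup>2" for k
    proof -
      define z where "z = 1 / (12 * (real k)\<^sup>2)"
      have e: "7 / (12 * (real k)\<^sup>2) = 7 * z" "1 / (2 * (real k)\<^sup>2) = 6 * z" "t k = 1/2 - z"
        by (simp_all add: z_def t_def)
      show ?thesis unfolding z_def[symmetric] e by (simp add: power2_eq_square algebra_simps)
    qed
    moreover have "(\<lambda>k. - (1 / (12 * (real k)\<^sup>2))\<^sup>2) \<in> O(\<lambda>k. 1 / real k ^ 3)"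
      by real_asymp
    ultimately have 4: "(\<lambda>k. 3/4 - 1 / (2 * real k) - 7 / (12 * (real k)\<^sup>2) - (t k)\<^sup>2
        - (1/2 - 1 / (2 * real k) - 1 / (2 * (real k)\<^sup>2))) \<in> O(\<lambda>k. 1 / real k ^ 3)"
      by simp
    from sum_in_bigo(1)[OF sum_in_bigo(2)[OF sum_in_bigo(2)[OF 1 2] 3] 4] show ?thesis
      by (simp add: power2_eq_square algebra_simps)
  qed
  have hsq: "(\<lambda>k. (h k)\<^sup>2 - ((l k)\<^sup>2 / 4 - l k / 12 * (1 / (real k)\<^sup>2))) \<in> O(\<lambda>k. ln (real k) / real k ^ 3)"
  proof -
    have lO: "(\<lambda>k. 2 * (l k / 2 - 1 / (12 * (real k)\<^sup>2))) \<in> O(\<lambda>k. ln (real k))"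
      unfolding l_def by real_asymp
    \<comment> \<open>This cross term puts ln k into the error: h itself grows like ln k and is
      known up to O(k^-3).\<close>
    have 1: "(\<lambda>k. 2 * (l k / 2 - 1 / (12 * (real k)\<^sup>2)) * r k) \<in> O(\<lambda>k. ln (real k) / real k ^ 3)"
      using landau_o.big.mult[OF lO r] by simp
    have 2: "(\<lambda>k. r k * r k) \<in> O(\<lambda>k. ln (real k) / real k ^ 3)"
      using landau_o.big.mult[OF landau_o.big_trans[OF r one] r] by (intro lift) simp
    have 3: "(\<lambda>k. 1 / (144 * real k ^ 4)) \<in> O(\<lambda>k. ln (real k) / real k ^ 3)"
      by real_asymp
    have eq: "(h k)\<^sup>2 - ((l k)\<^sup>2 / 4 - l k / 12 * (1 / (real k)\<^sup>2))
        = 2 * (l k / 2 - 1 / (12 * (real k)\<^sup>2)) * r k + r k * r k + 1 / (144 * real k ^ 4)" for k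
    proof -
      define z where "z = 1 / (12 * (real k)\<^sup>2)"
      have e: "1 / (144 * real k ^ 4) = z\<^sup>2" "l k / 12 * (1 / (real k)\<^sup>2) = l k * z" "h k = l k / 2 - z + r k"
        by (simp_all add: z_def r_def power_divide power_mult_distrib flip: power_mult)
      show ?thesis unfolding z_def[symmetric] e by (simp add: power2_eq_square algebra_simps)
    qed
    show ?thesis unfolding eq by (rule sum_in_bigo(1)[OF sum_in_bigo(1)[OF 1 2] 3])
  qed
  have "(\<lambda>k. (1 - \<delta>) * ((m2 k - (m1 k)\<^sup>2 - (1/2 - 1 / (2 * real k) - 1 / (2 * (real k)\<^sup>2)))
      + \<delta> * ((h k)\<^sup>2 - ((l k)\<^sup>2 / 4 - l k / 12 * (1 / (real k)\<^sup>2))))) \<in> O(\<lambda>k. ln (real k) / real k ^ 3)"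
    by (intro bigo_cmult sum_in_bigo(1) lift[OF var] hsq)
  moreover have "(1 - \<delta>) * ((m2 k - (m1 k)\<^sup>2 - (1/2 - 1 / (2 * real k) - 1 / (2 * (real k)\<^sup>2)))
      + \<delta> * ((h k)\<^sup>2 - ((l k)\<^sup>2 / 4 - l k / 12 * (1 / (real k)\<^sup>2))))
    = rac_V k \<delta> (\<lambda>_. 1/2)
           - (1 - \<delta>) * (\<delta> / 4 * (ln (pi * exp 1 * real k / 2))\<^sup>2 + 1/2 - 1 / (2 * real k)
               - (1/2 + \<delta> * ln (pi * exp 1 * real k / 2) / 12) * (1 / (real k)\<^sup>2))" for k
    unfolding V l_def[symmetric] by (simp add: algebra_simps)
  ultimately show "(\<lambda>k::nat. rac_V k \<delta> (\<lambda>_. 1/2)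
           - (1 - \<delta>) * (\<delta> / 4 * (ln (pi * exp 1 * real k / 2))\<^sup>2 + 1/2 - 1 / (2 * real k)
               - (1/2 + \<delta> * ln (pi * exp 1 * real k / 2) / 12) * (1 / (real k)\<^sup>2)))
         \<in> O(\<lambda>k. ln (real k) / (real k)^3)"
    by (simp only:)
qed

end
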